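(* For $\alpha,\beta\in Q$, the commutators of the operators $\Gamma_\alpha(z)$ and $\Gamma_\beta(w)$ on $V$ are given as follows. 1) If $(\alpha|\alpha)=2$, then $$[\Gamma_\alpha(z),\Gamma_\alpha(w)]=(\iota_{z,w}-\iota_{w,z})\left(\frac{w}{z+w}-\frac{w^2}{(z+w)^2}-\frac{\sqrt2\,w^2}{z+w}\sum_{j=1}^n(\alpha|S_j)\,a^{(j)}(w)\right).$$ 2) If $(\alpha|\beta)=1$, then $$[\Gamma_\alpha(z),\Gamma_\beta(w)]=-\nu(\alpha,\beta)\,(\iota_{z,w}-\iota_{w,z})\left(\frac{w}{z+w}\right)\Gamma_{-\alpha+\beta}(w).$$ 3) If $(\alpha|\beta)=-1$, then $$[\Gamma_\alpha(z),\Gamma_\beta(w)]=\nu(\alpha,\beta)\,(\iota_{z,w}-\iota_{w,z})\left(\frac{w}{z-w}\right)\Gamma_{\alpha+\beta}(w).$$ 4) If $(\alpha|\beta)=0$, then $[\Gamma_\alpha(z),\Gamma_\beta(w)]=0$.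
   Context: $\mathbf N_{\rm odd}$ is the set of positive odd integers and $\mathbf Z_{\rm odd}$ the set of odd integers. Let $\mathfrak h_{\mathbf R}$ be an $n$-dimensional real vector space with a positive definite symmetric bilinear form $(\,\cdot\,|\,\cdot\,)$, and $Q\subset\mathfrak h_{\mathbf R}$ an even integral lattice of rank $n$. Let $\mathfrak h$ be the complexification of $\mathfrak h_{\mathbf R}$ with the form extended bilinearly, and fix an orthonormal basis $S_1,\dots,S_n$ of $\mathfrak h$. Let $\nu:Q\times Q\to\{\pm1\}$ be an asymmetry function, i.e. a bimultiplicative function with $\nu(\alpha,\alpha)=(-1)^{\frac12(\alpha|\alpha)}$ and $\nu(\alpha,\beta)=(-1)^{(\alpha|\beta)}\nu(\beta,\alpha)$ for $\alpha,\beta\in Q$. $\mathbf C\{Q/2Q\}$ is the commutative group algebra of $Q/2Q$, with basis $e^\gamma$ ($\gamma\in Q/2Q$) and $e^\alpha e^\beta=e^{\alpha+\beta}$. Put $V=\mathbf C\{Q/2Q\}\otimes\mathbf C[x^{(j)}_r;\,1\le j\le n,\ r\in\mathbf N_{\rm odd}]$. For $\lambda=(\lambda_1,\dots,\lambda_n)\in\mathbf C^n$ let $$U_\lambda(z)=\exp\Big(\sum_{j=1}^n\sum_{r\in\mathbf N_{\rm odd}}\lambda_jx^{(j)}_rz^r\Big)\exp\Big(-\sum_{j=1}^n\sum_{r\in\mathbf N_{\rm odd}}\lambda_j\frac{z^{-r}}{r}\frac{\partial}{\partial x^{(j)}_r}\Big),$$ a formal series in $z^{\pm1}$ of operators on the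 polynomial ring. For $\alpha\in Q$ the operator $\Gamma_\alpha(z)$ on $V$ is $$\Gamma_\alpha(z)(e^\gamma\otimes f)=\tfrac12\,\nu(\alpha,\gamma)\,e^{\alpha+\gamma}\otimes U_{(\sqrt2(\alpha|S_1),\dots,\sqrt2(\alpha|S_n))}(z)f$$ (well defined since $\nu$ depends only on classes mod $2Q$). For $r\in\mathbf N_{\rm odd}$ put $a^{(j)}_r=\partial/\partial x^{(j)}_r$, $a^{(j)}_{-r}=r\,x^{(j)}_r$ (acting on the polynomial factor of $V$), and $a^{(j)}(z)=\sum_{r\in\mathbf Z_{\rm odd}}a^{(j)}_rz^{-r-1}$. For a rational function of $z,w$, $\iota_{z,w}$ (resp. $\iota_{w,z}$) denotes its series expansion in the domain $|z|>|w|$ (resp. $|w|>|z|$); operator coefficients depending only on $w$ are simply multiplied with the expanded rational functions. *)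

theory Defs
  imports "HOL-Analysis.Analysis" "HOL-Library.Poly_Mapping" "HOL-Library.Set_Algebras"
begin

section \<open>The real space, its complexification and the lattice\<close>

text \<open>The positive definite form on the real space is the inner product of the type class
  \<open>real_inner\<close>; the case of dimension 0 is not excluded.\<close>

definition has_dimension :: "'h::real_vector itself \<Rightarrow> nat \<Rightarrow> bool" where
  "has_dimension _ n \<longleftrightarrow>
     (\<exists>B::'h set. finite B \<and> card B = n \<and> independent B \<and> span B = UNIV)"

definition even_integral_lattice :: "nat \<Rightarrow> 'h::real_inner set \<Rightarrow> bool" where
  "even_integral_lattice n Q \<longleftrightarrow>
     (\<exists>B. finite B \<and> card B = n \<and> independent B \<and>
        Q = {\<Sum>b\<in>B. of_int (k b) *\<^sub>R b | k :: 'h \<Rightarrow> int. True}) \<and>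
     (\<forall>\<alpha>\<in>Q. \<forall>\<beta>\<in>Q. \<alpha> \<bullet> \<beta> \<in> \<int>) \<and>
     (\<forall>\<alpha>\<in>Q. \<alpha> \<bullet> \<alpha> / 2 \<in> \<int>)"

text \<open>The floors are exact, by integrality of the lattice.\<close>

definition asymmetry_function :: "'h::real_inner set \<Rightarrow> ('h \<Rightarrow> 'h \<Rightarrow> complex) \<Rightarrow> bool" where
  "asymmetry_function Q \<nu> \<longleftrightarrow>
     (\<forall>\<alpha>\<in>Q. \<forall>\<beta>\<in>Q. \<nu> \<alpha> \<beta> \<in> {1, -1}) \<and>
     (\<forall>\<alpha>\<in>Q. \<forall>\<beta>\<in>Q. \<forall>\<gamma>\<in>Q. \<nu> (\<alpha> + \<beta>) \<gamma> = \<nu> \<alpha> \<gamma> * \<nu> \<beta> \<gamma>) \<and>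
     (\<forall>\<alpha>\<in>Q. \<forall>\<beta>\<in>Q. \<forall>\<gamma>\<in>Q. \<nu> \<alpha> (\<beta> + \<gamma>) = \<nu> \<alpha> \<beta> * \<nu> \<alpha> \<gamma>) \<and>
     (\<forall>\<alpha>\<in>Q. \<nu> \<alpha> \<alpha> = (-1) powi \<lfloor>\<alpha> \<bullet> \<alpha> / 2\<rfloor>) \<and>
     (\<forall>\<alpha>\<in>Q. \<forall>\<beta>\<in>Q. \<nu> \<alpha> \<beta> = (-1) powi \<lfloor>\<alpha> \<bullet> \<beta>\<rfloor> * \<nu> \<beta> \<alpha>)"

text \<open>The complexification is \<open>'h \<times> 'h\<close>, where \<open>(x, y)\<close> stands for \<open>x + \<i> y\<close>. The form below is
  complex bilinear; it is neither Hermitian nor the library's inner product on pairs.\<close>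

definition cplx_scale :: "complex \<Rightarrow> 'h::real_vector \<times> 'h \<Rightarrow> 'h \<times> 'h" where
  "cplx_scale c v = (Re c *\<^sub>R fst v - Im c *\<^sub>R snd v, Re c *\<^sub>R snd v + Im c *\<^sub>R fst v)"

definition cplx_form :: "'h::real_inner \<times> 'h \<Rightarrow> 'h \<times> 'h \<Rightarrow> complex" where
  "cplx_form u v = Complex (fst u \<bullet> fst v - snd u \<bullet> snd v) (fst u \<bullet> snd v + snd u \<bullet> fst v)"

definition cplx_embed :: "'h::real_vector \<Rightarrow> 'h \<times> 'h" where
  "cplx_embed x = (x, 0)"

interpretation cplx: vector_space cplx_scale
  by unfold_locales (auto simp: cplx_scale_def algebra_simps)

definition orthonormal_cplx_basis :: "nat \<Rightarrow> (nat \<Rightarrow> 'h::real_inner \<times> 'h) \<Rightarrow> bool" where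
  "orthonormal_cplx_basis n S \<longleftrightarrow>
     cplx.independent (S ` {1..n}) \<and> cplx.span (S ` {1..n}) = UNIV \<and>
     (\<forall>i\<in>{1..n}. \<forall>j\<in>{1..n}. cplx_form (S i) (S j) = (if i = j then 1 else 0))"


section \<open>The space V\<close>

text \<open>The variable \<open>x\<^sup>(\<^sup>j\<^sup>)\<^sub>r\<close> has index \<open>(j, r)\<close>. Monomials are finitely supported exponent
  functions, and polynomials are finitely supported functions on monomials, with the convolution
  product of \<open>Poly_Mapping\<close>. The type allows all pairs \<open>(j, r)\<close> as indices;
  \<open>polyring n\<close> is the subring in which \<open>1 \<le> j \<le> n\<close> and \<open>r\<close> is odd.\<close>

type_synonym xpoly = "(nat \<times> nat \<Rightarrow>\<^sub>0 nat) \<Rightarrow>\<^sub>0 complex"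

definition polyring :: "nat \<Rightarrow> xpoly set" where
  "polyring n = {f. \<forall>m\<in>Poly_Mapping.keys f. \<forall>(j, r)\<in>Poly_Mapping.keys m. j \<in> {1..n} \<and> odd r}"

definition pvar :: "nat \<Rightarrow> nat \<Rightarrow> xpoly" where
  "pvar j r = Poly_Mapping.single (Poly_Mapping.single (j, r) 1) 1"

definition pscale :: "complex \<Rightarrow> xpoly \<Rightarrow> xpoly" where
  "pscale c f = Poly_Mapping.map ((*) c) f"

definition pdiff :: "nat \<Rightarrow> nat \<Rightarrow> xpoly \<Rightarrow> xpoly" where
  "pdiff j r f = (\<Sum>m\<in>Poly_Mapping.keys f. Poly_Mapping.single (m - Poly_Mapping.single (j, r) 1)
                     (of_nat (Poly_Mapping.lookup m (j, r)) * Poly_Mapping.lookup f m))"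

definition coset2 :: "'h::real_vector set \<Rightarrow> 'h \<Rightarrow> 'h set" where
  "coset2 Q \<gamma> = \<gamma> +o ((\<lambda>\<delta>. 2 *\<^sub>R \<delta>) ` Q)"

text \<open>An element of the tensor product is a finite sum of \<open>e\<^sup>\<gamma> \<otimes> f\<^sub>\<gamma>\<close> over classes \<open>\<gamma>\<close> in \<open>Q/2Q\<close>, i.e.
  a finitely supported function from classes to polynomials;
  \<open>e\<^sup>\<gamma> \<otimes> f\<close> is \<open>Poly_Mapping.single (coset2 Q \<gamma>) f\<close>.\<close>

type_synonym 'h Vspace = "'h set \<Rightarrow>\<^sub>0 xpoly"

definition Vcarrier :: "nat \<Rightarrow> 'h::real_vector set \<Rightarrow> 'h Vspace set" where
  "Vcarrier n Q = {v. Poly_Mapping.keys v \<subseteq> coset2 Q ` Q \<and> (\<forall>C. Poly_Mapping.lookup v C \<in> polyring n)}"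

definition vscale :: "complex \<Rightarrow> 'h Vspace \<Rightarrow> 'h Vspace" where
  "vscale c v = Poly_Mapping.map (pscale c) v"


section \<open>Exponentials of operator-valued power series\<close>

text \<open>\<open>A m\<close> is the coefficient of \<open>u\<^sup>m\<close> of a power series in \<open>u\<close> with operator coefficients.
  The exponential is only used for series without constant term; then the \<open>k\<close>-th power
  contributes only to coefficients \<open>m \<ge> k\<close>.\<close>

type_synonym opseries = "nat \<Rightarrow> xpoly \<Rightarrow> xpoly"

definition ops_mult :: "opseries \<Rightarrow> opseries \<Rightarrow> opseries" where
  "ops_mult A B m f = (\<Sum>i\<le>m. A i (B (m - i) f))"

primrec ops_power :: "opseries \<Rightarrow> nat \<Rightarrow> opseries" where
  "ops_power A 0 = (\<lambda>m f. if m = 0 then f else 0)"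
| "ops_power A (Suc k) = ops_mult A (ops_power A k)"

definition ops_exp :: "opseries \<Rightarrow> opseries" where
  "ops_exp A m f = (\<Sum>k\<le>m. pscale (1 / fact k) (ops_power A k m f))"


section \<open>Vertex operators\<close>

text \<open>\<open>creation n lam\<close> is a series in \<open>z\<close> and \<open>annihilation n lam\<close> is a series in \<open>z\<^sup>-\<^sup>1\<close>.\<close>

definition creation :: "nat \<Rightarrow> (nat \<Rightarrow> complex) \<Rightarrow> opseries" where
  "creation n lam r f =
     (if odd r then (\<Sum>j=1..n. pscale (lam j) (pvar j r * f)) else 0)"

definition annihilation :: "nat \<Rightarrow> (nat \<Rightarrow> complex) \<Rightarrow> opseries" where
  "annihilation n lam r f =
     (if odd r then (\<Sum>j=1..n. pscale (- lam j / of_nat r) (pdiff j r f)) else 0)"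

text \<open>\<open>Uop n lam m f\<close> is the coefficient of \<open>z\<^sup>m\<close> in \<open>U\<^sub>\<lambda>(z) f\<close>. The second exponential applied to \<open>f\<close> is
  a polynomial in \<open>z\<^sup>-\<^sup>1\<close>, so that the sum over \<open>l\<close> has finite support.\<close>

definition Uop :: "nat \<Rightarrow> (nat \<Rightarrow> complex) \<Rightarrow> int \<Rightarrow> xpoly \<Rightarrow> xpoly" where
  "Uop n lam m f =
     Sum_any (\<lambda>l::nat. if m + int l \<ge> 0
       then ops_exp (creation n lam) (nat (m + int l)) (ops_exp (annihilation n lam) l f)
       else 0)"

text \<open>A formal distribution \<open>A(z)\<close> on \<open>V\<close> is given by \<open>A m\<close>, its coefficient of \<open>z\<^sup>m\<close>; likewise
  \<open>A m k\<close> is the coefficient of \<open>z\<^sup>m w\<^sup>k\<close> of a formal distribution in \<open>z, w\<close>.\<close>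

type_synonym 'h dist = "int \<Rightarrow> 'h Vspace \<Rightarrow> 'h Vspace"
type_synonym 'h dist2 = "int \<Rightarrow> int \<Rightarrow> 'h Vspace \<Rightarrow> 'h Vspace"

text \<open>The value of \<open>\<nu> \<alpha>\<close> on a class \<open>C\<close> is taken at a chosen representative, and \<open>\<alpha> +o C\<close> is the
  class \<open>\<alpha> + C\<close>; see \<open>Gam_single\<close> below.\<close>

definition Gam :: "nat \<Rightarrow> ('h::real_inner \<Rightarrow> 'h \<Rightarrow> complex) \<Rightarrow> (nat \<Rightarrow> 'h \<times> 'h) \<Rightarrow> 'h \<Rightarrow> 'h dist" where
  "Gam n \<nu> S \<alpha> m v =
     (\<Sum>C\<in>Poly_Mapping.keys v. Poly_Mapping.single (\<alpha> +o C)
        (pscale (1/2 * \<nu> \<alpha> (SOME \<gamma>. \<gamma> \<in> C))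
          (Uop n (\<lambda>j. of_real (sqrt 2) * cplx_form (cplx_embed \<alpha>) (S j)) m (Poly_Mapping.lookup v C))))"

definition heis :: "nat \<Rightarrow> int \<Rightarrow> xpoly \<Rightarrow> xpoly" where
  "heis j r f =
     (if r > 0 then pdiff j (nat r) f else pscale (of_int (- r)) (pvar j (nat (- r)) * f))"

text \<open>The coefficient of \<open>z\<^sup>k\<close> in \<open>a\<^sup>(\<^sup>j\<^sup>)(z)\<close> is \<open>a\<^sup>(\<^sup>j\<^sup>)\<^sub>r\<close> with \<open>r = - k - 1\<close>.\<close>

definition afield :: "nat \<Rightarrow> 'h dist" where
  "afield j k v = (if odd (- k - 1) then Poly_Mapping.map (heis j (- k - 1)) v else 0)"

definition dist_commutator :: "'h dist \<Rightarrow> 'h dist \<Rightarrow> 'h dist2" where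
  "dist_commutator A B m k v = A m (B k v) - B k (A m v)"


section \<open>Expansions of rational functions\<close>

text \<open>\<open>c m k\<close> is the coefficient of \<open>z\<^sup>m w\<^sup>k\<close>. The Laurent series representing a function on one of the
  two domains is unique if it exists; see \<open>iota_zw_eqI\<close> and \<open>iota_wz_eqI\<close> below.\<close>

definition iota_zw :: "(complex \<Rightarrow> complex \<Rightarrow> complex) \<Rightarrow> int \<Rightarrow> int \<Rightarrow> complex" where
  "iota_zw R = (THE c. \<forall>z w. 0 < norm w \<and> norm w < norm z \<longrightarrow>
     ((\<lambda>(m, k). c m k * z powi m * w powi k) has_sum R z w) UNIV)"

definition iota_wz :: "(complex \<Rightarrow> complex \<Rightarrow> complex) \<Rightarrow> int \<Rightarrow> int \<Rightarrow> complex" where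
  "iota_wz R = (THE c. \<forall>z w. 0 < norm z \<and> norm z < norm w \<longrightarrow>
     ((\<lambda>(m, k). c m k * z powi m * w powi k) has_sum R z w) UNIV)"

definition iota_diff :: "(complex \<Rightarrow> complex \<Rightarrow> complex) \<Rightarrow> int \<Rightarrow> int \<Rightarrow> complex" where
  "iota_diff R m k = iota_zw R m k - iota_wz R m k"

text \<open>The product of a scalar distribution in \<open>z, w\<close> with an operator distribution \<open>A(w)\<close>. It is used
  only where, for each power of \<open>z\<close>, finitely many powers of \<open>w\<close> occur in the scalar factor.\<close>

definition dist_mult :: "(int \<Rightarrow> int \<Rightarrow> complex) \<Rightarrow> 'h dist \<Rightarrow> 'h dist2" where
  "dist_mult c A m k v = Sum_any (\<lambda>l. vscale (c m l) (A (k - l) v))"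


section \<open>Well-definedness\<close>

lemma pscale_0 [simp]: "pscale c 0 = 0"
  by (rule poly_mapping_eqI) (simp add: pscale_def Poly_Mapping.map.rep_eq)

lemma ops_power_0:
  assumes "\<And>m. A m 0 = 0"
  shows "ops_power A k m 0 = 0"
  using assms by (induction k arbitrary: m) (auto simp: ops_mult_def)

lemma Uop_0: "Uop n lam m 0 = 0"
proof -
  have c: "creation n lam r 0 = 0" and a: "annihilation n lam r 0 = 0" for r
    by (auto simp: creation_def annihilation_def pdiff_def)
  have "ops_exp (creation n lam) l 0 = 0" "ops_exp (annihilation n lam) l 0 = 0" for l
    by (simp_all add: ops_exp_def ops_power_0 c a)
  then show ?thesis by (simp add: Uop_def cong: if_cong)
qed

lemma even_integral_lattice_add_diff:
  assumes "even_integral_lattice n Q" "\<alpha> \<in> Q" "\<beta> \<in> Q"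
  shows "\<alpha> + \<beta> \<in> Q" "\<alpha> - \<beta> \<in> Q"
proof -
  obtain B where Q: "Q = {\<Sum>b\<in>B. of_int (k b) *\<^sub>R b | k :: _ \<Rightarrow> int. True}"
    using assms(1) unfolding even_integral_lattice_def by blast
  obtain k l :: "_ \<Rightarrow> int" where kl: "\<alpha> = (\<Sum>b\<in>B. of_int (k b) *\<^sub>R b)" "\<beta> = (\<Sum>b\<in>B. of_int (l b) *\<^sub>R b)"
    using assms(2,3) unfolding Q by blast
  have "\<alpha> + \<beta> = (\<Sum>b\<in>B. of_int (k b + l b) *\<^sub>R b)"
    by (simp add: kl sum.distrib scaleR_left_distrib)
  then show "\<alpha> + \<beta> \<in> Q" unfolding Q by (intro CollectI exI[of _ "\<lambda>b. k b + l b"]) simp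
  have "\<alpha> - \<beta> = (\<Sum>b\<in>B. of_int (k b - l b) *\<^sub>R b)"
    by (simp add: kl sum_subtractf scaleR_left_diff_distrib)
  then show "\<alpha> - \<beta> \<in> Q" unfolding Q by (intro CollectI exI[of _ "\<lambda>b. k b - l b"]) simp
qed

lemma Gam_single:
  assumes "even_integral_lattice n Q" "asymmetry_function Q \<nu>" "\<alpha> \<in> Q" "\<gamma> \<in> Q"
  shows "Gam n \<nu> S \<alpha> m (Poly_Mapping.single (coset2 Q \<gamma>) f) =
    Poly_Mapping.single (coset2 Q (\<alpha> + \<gamma>))
      (pscale (1/2 * \<nu> \<alpha> \<gamma>)
        (Uop n (\<lambda>j. of_real (sqrt 2) * cplx_form (cplx_embed \<alpha>) (S j)) m f))"
proof -
  have "(0::'a) \<in> Q" using even_integral_lattice_add_diff(2)[OF assms(1,4,4)] by simp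
  then have "\<gamma> \<in> coset2 Q \<gamma>" by (force simp: coset2_def elt_set_plus_def)
  then have "(SOME \<gamma>'. \<gamma>' \<in> coset2 Q \<gamma>) \<in> coset2 Q \<gamma>" by (rule someI)
  then obtain \<delta> where \<delta>: "\<delta> \<in> Q" "(SOME \<gamma>'. \<gamma>' \<in> coset2 Q \<gamma>) = \<gamma> + (\<delta> + \<delta>)"
    by (auto simp: coset2_def elt_set_plus_def scaleR_2)
  have mult: "\<nu> \<alpha> (\<beta> + \<beta>') = \<nu> \<alpha> \<beta> * \<nu> \<alpha> \<beta>'" if "\<beta> \<in> Q" "\<beta>' \<in> Q" for \<beta> \<beta>'
    using assms(2,3) that unfolding asymmetry_function_def by blast
  have "\<nu> \<alpha> (\<gamma> + (\<delta> + \<delta>)) = \<nu> \<alpha> \<gamma> * (\<nu> \<alpha> \<delta> * \<nu> \<alpha> \<delta>)"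
    using even_integral_lattice_add_diff(1)[OF assms(1) \<delta>(1) \<delta>(1)]
    by (simp only: mult assms(4) \<delta>(1))
  moreover have "\<nu> \<alpha> \<delta> \<in> {1, -1}"
    using assms(2,3) \<delta>(1) unfolding asymmetry_function_def by blast
  then have "\<nu> \<alpha> \<delta> * \<nu> \<alpha> \<delta> = 1" by auto
  ultimately have \<nu>: "\<nu> \<alpha> (SOME \<gamma>'. \<gamma>' \<in> coset2 Q \<gamma>) = \<nu> \<alpha> \<gamma>" by (simp add: \<delta>(2))
  have "\<alpha> +o coset2 Q \<gamma> = coset2 Q (\<alpha> + \<gamma>)"
    by (simp add: coset2_def set_plus_rearrange2)
  then show ?thesis by (cases "f = 0") (simp_all add: Gam_def \<nu> Uop_0)
qed

lemma cis_root_sum: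
  fixes d :: int and N :: nat
  assumes "N > 0"
  shows "(\<Sum>i<N. cis (2 * pi * real i / real N) powi d) = (if int N dvd d then of_nat N else 0)"
proof -
  define \<omega> where "\<omega> = cis (2 * pi * of_int d / real N)"
  have p: "cis (2 * pi * real i / real N) powi d = \<omega> ^ i" for i
    by (simp add: \<omega>_def Complex.DeMoivre cis_power_int algebra_simps)
  have N: "\<omega> ^ N = 1"
    using assms by (simp add: \<omega>_def Complex.DeMoivre cis_multiple_2pi)
  have "\<omega> = 1 \<longleftrightarrow> int N dvd d"
  proof
    assume "\<omega> = 1"
    then have "cos (2 * pi * of_int d / real N) = 1" by (simp add: \<omega>_def complex_eq_iff)
    then obtain x :: int where "2 * pi * of_int d / real N = of_int x * 2 * pi"
      by (auto simp: cos_one_2pi_int)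
    then have "real_of_int d = of_int (x * int N)" using assms by (simp add: field_simps)
    then have "d = x * int N" by (simp only: of_int_eq_iff)
    then show "int N dvd d" by simp
  next
    assume "int N dvd d"
    then obtain x where "d = int N * x" by auto
    then have "2 * pi * of_int d / real N = 2 * pi * of_int x" using assms by simp
    then show "\<omega> = 1" unfolding \<omega>_def by (metis cis_multiple_2pi Ints_of_int)
  qed
  moreover have "(\<Sum>i<N. \<omega> ^ i) = (if \<omega> = 1 then of_nat N else 0)"
    by (simp add: geometric_sum N)
  ultimately show ?thesis by (simp add: p)
qed

lemma has_sum_finite_sum:
  fixes f :: "'i \<Rightarrow> 'b \<Rightarrow> complex"
  assumes "finite I" "\<And>i. i \<in> I \<Longrightarrow> (f i has_sum s i) A"
  shows "((\<lambda>p. \<Sum>i\<in>I. f i p) has_sum (\<Sum>i\<in>I. s i)) A"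
  using assms by (induction I) (auto intro: has_sum_add)

lemma double_laurent_zero:
  fixes a :: "int \<Rightarrow> int \<Rightarrow> complex"
  assumes "\<And>s t. norm s = 1 \<Longrightarrow> norm t = 1 \<Longrightarrow> ((\<lambda>(m, k). a m k * s powi m * t powi k) has_sum 0) UNIV"
  shows "a M K = 0"
proof (rule ccontr)
  assume nz: "a M K \<noteq> 0"
  define f where "f = (\<lambda>(m, k). a m k)"
  have "(f has_sum 0) UNIV" using assms[of 1 1] by (simp add: f_def)
  then have "(\<lambda>p. norm (f p)) summable_on UNIV"
    using summable_on_iff_abs_summable_on_complex has_sum_imp_summable by blast
  then obtain A where A: "((\<lambda>p. norm (f p)) has_sum A) UNIV" by (auto simp: summable_on_def)
  have "eventually (\<lambda>F. dist (sum (\<lambda>p. norm (f p)) F) A < norm (a M K)) (finite_subsets_at_top UNIV)"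
    using A nz unfolding has_sum_def by (intro tendstoD) auto
  then obtain F where "finite F" and
      near: "\<forall>G. finite G \<and> F \<subseteq> G \<and> G \<subseteq> UNIV \<longrightarrow> dist (sum (\<lambda>p. norm (f p)) G) A < norm (a M K)"
    unfolding eventually_finite_subsets_at_top by (elim exE conjE) (rule that)
  have F: "dist (sum (\<lambda>p. norm (f p)) G) A < norm (a M K)" if "finite G" "F \<subseteq> G" for G
    using near that by simp
  define F' where "F' = insert (M, K) F"
  have F': "finite F'" using \<open>finite F\<close> by (simp add: F'_def)
  have F'_tail: "A - sum (\<lambda>p. norm (f p)) F' < norm (a M K)"
    using F[OF F'] by (simp add: F'_def subset_insertI dist_real_def)
  have tail: "((\<lambda>p. norm (f p)) has_sum (A - sum (\<lambda>p. norm (f p)) F')) (UNIV - F')"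
    by (rule has_sum_Diff[OF A has_sum_finite[OF F']]) auto
  define N where "N = Suc (nat (\<Sum>p\<in>F'. \<bar>fst p - M\<bar> + \<bar>snd p - K\<bar>))"
  have N: "N > 0" by (simp add: N_def)
  have small: "m = M \<and> k = K" if "(m, k) \<in> F'" "int N dvd m - M" "int N dvd k - K" for m k
  proof -
    have "\<bar>fst (m,k) - M\<bar> + \<bar>snd (m,k) - K\<bar> \<le> (\<Sum>p\<in>F'. \<bar>fst p - M\<bar> + \<bar>snd p - K\<bar>)"
      by (rule member_le_sum[OF that(1)]) (auto simp: F')
    then have "\<bar>m - M\<bar> < int N" "\<bar>k - K\<bar> < int N" by (auto simp: N_def)
    then show ?thesis using that(2,3) by (metis dvd_imp_le_int abs_of_nat linorder_not_le right_minus_eq)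
  qed
  define \<zeta> where "\<zeta> = (\<lambda>i::nat. cis (2 * pi * real i / real N))"
  have nz': "\<zeta> i \<noteq> 0" for i by (simp add: \<zeta>_def)
  define ch where "ch = (\<lambda>m k::int. if int N dvd m - M \<and> int N dvd k - K then 1 else (0::complex))"
  have "((\<lambda>p. \<Sum>i<N. \<Sum>j<N. \<zeta> i powi (-M) * \<zeta> j powi (-K) * (case p of (m, k) \<Rightarrow> a m k * \<zeta> i powi m * \<zeta> j powi k))
          has_sum (\<Sum>i<N. \<Sum>j<N. \<zeta> i powi (-M) * \<zeta> j powi (-K) * 0)) UNIV"
    by (intro has_sum_finite_sum has_sum_cmult_right assms) (auto simp: \<zeta>_def)
  also have "(\<lambda>p. \<Sum>i<N. \<Sum>j<N. \<zeta> i powi (-M) * \<zeta> j powi (-K) * (case p of (m, k) \<Rightarrow> a m k * \<zeta> i powi m * \<zeta> j powi k))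
      = (\<lambda>(m, k). of_nat (N * N) * (a m k * ch m k))"
  proof (rule ext, clarify)
    fix m k
    have "(\<Sum>i<N. \<Sum>j<N. \<zeta> i powi (-M) * \<zeta> j powi (-K) * (a m k * \<zeta> i powi m * \<zeta> j powi k))
      = (\<Sum>i<N. \<Sum>j<N. a m k * (\<zeta> i powi (m - M) * \<zeta> j powi (k - K)))"
      by (intro sum.cong refl) (simp add: nz' power_int_diff power_int_minus field_simps)
    also have "\<dots> = a m k * ((\<Sum>i<N. \<zeta> i powi (m - M)) * (\<Sum>j<N. \<zeta> j powi (k - K)))"
      by (simp only: sum_product sum_distrib_left[symmetric])
    also have "\<dots> = of_nat (N * N) * (a m k * ch m k)"
      unfolding \<zeta>_def cis_root_sum[OF N] by (simp add: ch_def)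
    finally show "(\<Sum>i<N. \<Sum>j<N. \<zeta> i powi (-M) * \<zeta> j powi (-K) * (a m k * \<zeta> i powi m * \<zeta> j powi k))
      = of_nat (N * N) * (a m k * ch m k)" .
  qed
  finally have "((\<lambda>(m, k). of_nat (N * N) * (a m k * ch m k)) has_sum 0) UNIV" by simp
  then have "((\<lambda>p. of_nat (N * N) * (case p of (m, k) \<Rightarrow> a m k * ch m k)) has_sum 0) UNIV"
    by (simp add: case_prod_unfold)
  from has_sum_cmult_right[OF this, of "1 / of_nat (N * N)"]
  have g: "((\<lambda>(m, k). a m k * ch m k) has_sum 0) UNIV" using N by (simp add: case_prod_unfold)
  have "(\<Sum>p\<in>F'. (case p of (m, k) \<Rightarrow> a m k * ch m k)) = (\<Sum>p\<in>{(M, K)}. (case p of (m, k) \<Rightarrow> a m k * ch m k))"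
  proof (rule sum.mono_neutral_right[OF F'])
    show "{(M, K)} \<subseteq> F'" by (simp add: F'_def)
    show "\<forall>p\<in>F' - {(M, K)}. (case p of (m, k) \<Rightarrow> a m k * ch m k) = 0"
    proof
      fix p assume p: "p \<in> F' - {(M, K)}"
      obtain m k where mk: "p = (m, k)" by (cases p)
      have "\<not> (int N dvd m - M \<and> int N dvd k - K)" using small[of m k] p mk by blast
      then show "(case p of (m, k) \<Rightarrow> a m k * ch m k) = 0" unfolding mk ch_def by auto
    qed
  qed
  then have "(\<Sum>p\<in>F'. (case p of (m, k) \<Rightarrow> a m k * ch m k)) = a M K" by (simp add: ch_def)
  then have "((\<lambda>(m, k). a m k * ch m k) has_sum (0 - a M K)) (UNIV - F')"
    using has_sum_Diff[OF g has_sum_finite[OF F']] by simp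
  then have "norm (0 - a M K) \<le> A - sum (\<lambda>p. norm (f p)) F'"
    by (rule norm_infsum_le[OF _ tail]) (auto simp: f_def ch_def norm_mult)
  then show False using F'_tail by simp
qed

lemma laurent_unique:
  fixes c d :: "int \<Rightarrow> int \<Rightarrow> complex" and r q :: real
  assumes "r > 0" "q > 0"
    and "\<And>z w. norm z = r \<Longrightarrow> norm w = q \<Longrightarrow>
      ((\<lambda>(m, k). c m k * z powi m * w powi k) has_sum R z w) UNIV"
    and "\<And>z w. norm z = r \<Longrightarrow> norm w = q \<Longrightarrow>
      ((\<lambda>(m, k). d m k * z powi m * w powi k) has_sum R z w) UNIV"
  shows "c = d"
proof (intro ext)
  fix M K
  have "(c M K - d M K) * of_real r powi M * of_real q powi K = 0"
  proof (rule double_laurent_zero)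
    fix s t :: complex assume st: "norm s = 1" "norm t = 1"
    from st assms(1,2) have n: "norm (of_real r * s) = r" "norm (of_real q * t) = q"
      by (simp_all add: norm_mult)
    from has_sum_add[OF assms(3)[OF n] has_sum_uminusI[OF assms(4)[OF n]]]
    show "((\<lambda>(m, k). (c m k - d m k) * of_real r powi m * of_real q powi k * s powi m * t powi k)
            has_sum 0) UNIV"
      by (simp add: case_prod_unfold power_int_mult_distrib algebra_simps)
  qed
  then show "c M K = d M K" using assms(1,2) by simp
qed

lemma iota_zw_eqI:
  assumes "\<And>z w. 0 < norm w \<Longrightarrow> norm w < norm z \<Longrightarrow>
     ((\<lambda>(m, k). c m k * z powi m * w powi k) has_sum R z w) UNIV"
  shows "iota_zw R = c"
  unfolding iota_zw_def
  by (rule the_equality, use assms in blast, rule laurent_unique[of 2 1 _ R];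
      use assms in \<open>force simp del: zero_less_norm_iff\<close>)

lemma iota_wz_eqI:
  assumes "\<And>z w. 0 < norm z \<Longrightarrow> norm z < norm w \<Longrightarrow>
     ((\<lambda>(m, k). c m k * z powi m * w powi k) has_sum R z w) UNIV"
  shows "iota_wz R = c"
  unfolding iota_wz_def
  by (rule the_equality, use assms in blast, rule laurent_unique[of 1 2 _ R];
      use assms in \<open>force simp del: zero_less_norm_iff\<close>)

end

theory Submission
  imports Defs
begin

text \<open>Moving the derivatives of \<open>U\<^sub>\<lambda>(z)\<close> past the variables of \<open>U\<^sub>\<mu>(w)\<close> costs a scalar factor:
  for \<open>|z| > |w|\<close>,
  \<open>U\<^sub>\<lambda>(z) U\<^sub>\<mu>(w) = ((z - w) / (z + w)) powr (s / 2) : U\<^sub>\<lambda>(z) U\<^sub>\<mu>(w) :\<close> with \<open>s = \<Sum>\<^sub>j \<lambda>\<^sub>j \<mu>\<^sub>j\<close>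
  (lemma \<open>Uop_Uop\<close>). The normally ordered product is symmetric in its two factors, and for the
  vectors belonging to \<open>\<alpha>\<close> and \<open>\<beta>\<close> the exponent \<open>s / 2\<close> is the integer \<open>(\<alpha>|\<beta>)\<close>, because the basis is
  orthonormal. In the opposite order the rational function is therefore the same up to the sign
  \<open>(-1)\<^sup>(\<^sup>\<alpha>\<^sup>|\<^sup>\<beta>\<^sup>)\<close>, which the asymmetry of \<open>\<nu>\<close> compensates. So the commutator is a scalar times
  \<open>(\<iota>\<^sub>z\<^sub>,\<^sub>w - \<iota>\<^sub>w\<^sub>,\<^sub>z) ((z - w) / (z + w)) ^ (\<alpha>|\<beta>)\<close> times the normally ordered product
  (\<open>Uop_commutator\<close>).

  The difference of the two expansions is supported on the poles of the rational function, hence only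
  the behaviour of the normally ordered product there matters. If \<open>(\<alpha>|\<beta>) = 0\<close> there is no pole. If it
  is \<open>-1\<close>, the pole \<open>z = w\<close> is simple and the product restricts to \<open>U\<^sub>\<alpha>\<^sub>+\<^sub>\<beta>(w)\<close> there
  (\<open>sum_normal_product\<close>). If it is \<open>1\<close>, the pole is \<open>z = -w\<close>, and \<open>U\<^sub>\<alpha>(-w) = U\<^sub>-\<^sub>\<alpha>(w)\<close> since only odd
  powers occur (\<open>normal_product_uminus\<close>). If \<open>\<alpha> = \<beta>\<close> and \<open>(\<alpha>|\<alpha>) = 2\<close>, the pole \<open>z = -w\<close> is double; the
  normally ordered product is the identity on it, and its first derivative is the Heisenberg field
  (\<open>sum_index_normal_product\<close>).

  In coefficients, restriction to \<open>z = w\<close> is summation over the antidiagonal of the exponents \<open>(a, b)\<close>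
  with \<open>a + b\<close> fixed. On a given polynomial all sums are finite, because the annihilation part of
  degree \<open>l\<close> lowers the weight by \<open>l\<close>.

  The exponentials are handled only through the differential equation \<open>u E' = u A' E\<close>
  (\<open>euler_exp\<close>), which determines \<open>E = exp A\<close>: functional equations of exponentials become
  comparisons of two solutions (\<open>exp_unique\<close>).\<close>

section \<open>Linear operators on polynomials\<close>

lemma pscale_conv_mult: "pscale c f = Poly_Mapping.single 0 c * f"
  by (simp add: pscale_def mult_map_scale_conv_mult)

interpretation poly: vector_space pscale
  by unfold_locales
    (simp_all add: pscale_conv_mult distrib_left distrib_right single_add mult_single flip: mult.assoc)

lemma lookup_pscale [simp]: "Poly_Mapping.lookup (pscale c f) m = c * Poly_Mapping.lookup f m"
  by (simp add: pscale_def Poly_Mapping.map.rep_eq when_def)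

lemma pscale_mult_left: "pscale c f * g = pscale c (f * g)"
  by (simp add: pscale_conv_mult mult.assoc)

lemma pscale_mult_right: "f * pscale c g = pscale c (f * g)"
  by (simp add: pscale_conv_mult mult_ac)

abbreviation lin :: "(xpoly \<Rightarrow> xpoly) \<Rightarrow> bool" where
  "lin T \<equiv> module_hom pscale pscale T"

lemma linI:
  assumes "\<And>f g. T (f + g) = T f + T g" "\<And>c f. T (pscale c f) = pscale c (T f)"
  shows "lin T"
  by unfold_locales (simp_all add: assms)

lemma lin_const_0: "lin (\<lambda>f. 0)"
  by (rule linI) simp_all

lemma lin_ident: "lin (\<lambda>f. f)"
  by (rule linI) simp_all

lemma lin_compose: "lin S \<Longrightarrow> lin T \<Longrightarrow> lin (\<lambda>f. S (T f))"
  by (rule linI) (simp_all add: module_hom.add module_hom.scale)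

lemma lin_add: "lin S \<Longrightarrow> lin T \<Longrightarrow> lin (\<lambda>f. S f + T f)"
  by (rule linI) (simp_all add: module_hom.add module_hom.scale poly.scale_right_distrib)

lemma lin_pscale: "lin T \<Longrightarrow> lin (\<lambda>f. pscale c (T f))"
  by (rule linI) (simp_all add: module_hom.add module_hom.scale poly.scale_right_distrib mult_ac)

lemma lin_sum:
  assumes "\<And>i. i \<in> I \<Longrightarrow> lin (T i)"
  shows "lin (\<lambda>f. \<Sum>i\<in>I. T i f)"
  by (rule linI)
    (simp_all add: module_hom.add[OF assms] module_hom.scale[OF assms] sum.distrib
      poly.scale_sum_right)

lemma lin_mult: "lin (\<lambda>f. g * f)"
  by (rule linI) (simp_all add: distrib_left pscale_mult_right)

lemmas lin_intros = lin_const_0 lin_ident lin_add lin_pscale lin_sum lin_mult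


section \<open>Exponentials of series of commuting operators\<close>

text \<open>Associativity of Cauchy products comes down to the reordering of sums over a triangle, in one of
  two shapes.\<close>

lemma sum_triangle_swap:
  fixes g :: "nat \<Rightarrow> nat \<Rightarrow> 'a::comm_monoid_add"
  shows "(\<Sum>i\<le>m. \<Sum>j\<le>m - i. g i j) = (\<Sum>j\<le>m. \<Sum>i\<le>m - j. g i j)"
proof -
  have "(\<Sum>i\<le>m. \<Sum>j\<le>m - i. g i j) = (\<Sum>(i, j)\<in>(SIGMA i:{..m}. {..m - i}). g i j)"
    by (simp add: sum.Sigma)
  also have "\<dots> = (\<Sum>(j, i)\<in>(SIGMA j:{..m}. {..m - j}). g i j)"
    by (rule sum.reindex_bij_witness[of _ "\<lambda>(j, i). (i, j)" "\<lambda>(i, j). (j, i)"]) auto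
  finally show ?thesis by (simp add: sum.Sigma)
qed

lemma sum_triangle_diag:
  fixes g :: "nat \<Rightarrow> nat \<Rightarrow> 'a::comm_monoid_add"
  shows "(\<Sum>i\<le>m. \<Sum>j\<le>i. g j (i - j)) = (\<Sum>j\<le>m. \<Sum>i\<le>m - j. g j i)"
proof -
  have "(\<Sum>i\<le>m. \<Sum>j\<le>i. g j (i - j)) = (\<Sum>(i, j)\<in>(SIGMA i:{..m}. {..i}). g j (i - j))"
    by (simp add: sum.Sigma)
  also have "\<dots> = (\<Sum>(j, i)\<in>(SIGMA j:{..m}. {..m - j}). g j i)"
    by (rule sum.reindex_bij_witness[of _ "\<lambda>(j, i). (i + j, j)" "\<lambda>(i, j). (j, i - j)"]) auto
  finally show ?thesis by (simp add: sum.Sigma)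
qed

locale commuting_series =
  fixes A :: opseries
  assumes lin: "lin (A m)"
    and zero: "A 0 f = 0"
    and comm: "A i (A j f) = A j (A i f)"
begin

lemma lin_power: "lin (ops_power A k m)"
proof (induction k arbitrary: m)
  case 0
  show ?case by (cases "m = 0") (simp_all add: lin_const_0 lin_ident)
next
  case (Suc k)
  show ?case
    unfolding ops_power.simps ops_mult_def[abs_def] by (intro lin_sum lin_compose[OF lin] Suc.IH)
qed

lemma lin_exp: "lin (ops_exp A m)"
  unfolding ops_exp_def[abs_def] by (intro lin_sum lin_pscale lin_power)

lemma power_eq_0: "m < k \<Longrightarrow> ops_power A k m f = 0"
proof (induction k arbitrary: m)
  case (Suc k)
  have "A i (ops_power A k (m - i) f) = 0" if "i \<le> m" for i
  proof (cases "i = 0")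
    case False
    then have "ops_power A k (m - i) f = 0" using Suc that by simp
    then show ?thesis by (simp add: module_hom.zero[OF lin])
  qed (simp add: zero)
  then show ?case by (simp add: ops_mult_def)
qed simp

lemma power_commute:
  assumes "lin T" "\<And>i f. A i (T f) = T (A i f)"
  shows "ops_power A k m (T f) = T (ops_power A k m f)"
  using assms(2)
  by (induction k arbitrary: m)
    (auto simp: ops_mult_def module_hom.zero[OF assms(1)] module_hom.sum[OF assms(1)])

lemma exp_commute:
  assumes "lin T" "\<And>i f. A i (T f) = T (A i f)"
  shows "ops_exp A m (T f) = T (ops_exp A m f)"
  by (simp add: ops_exp_def power_commute[OF assms] module_hom.sum[OF assms(1)]
      module_hom.scale[OF assms(1)])

lemma exp_0: "ops_exp A 0 f = f"
  by (simp add: ops_exp_def)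

lemma exp_upto: "m \<le> K \<Longrightarrow> ops_exp A m f = (\<Sum>k\<le>K. pscale (1 / fact k) (ops_power A k m f))"
  unfolding ops_exp_def by (rule sum.mono_neutral_left) (auto simp: power_eq_0)

text \<open>The chain rule for the Euler operator \<open>u d/du\<close>; it holds because the coefficients commute, so
  that the differentiated factor can be moved to the front.\<close>

lemma euler_power:
  "pscale (of_nat m) (ops_power A (Suc k) m f) =
   pscale (of_nat (Suc k)) (\<Sum>i\<le>m. pscale (of_nat i) (A i (ops_power A k (m - i) f)))"
proof (induction k arbitrary: m f)
  case 0
  have "ops_power A (Suc 0) m f = (\<Sum>i\<le>m. if i = m then A m f else 0)"
    unfolding ops_power.simps ops_mult_def
    by (rule sum.cong) (auto simp: module_hom.zero[OF lin])
  then have "ops_power A (Suc 0) m f = A m f" by simp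
  moreover have "(\<Sum>i\<le>m. pscale (of_nat i) (A i (ops_power A 0 (m - i) f))) = pscale (of_nat m) (A m f)"
  proof -
    have "(\<Sum>i\<le>m. pscale (of_nat i) (A i (ops_power A 0 (m - i) f)))
        = (\<Sum>i\<le>m. if i = m then pscale (of_nat m) (A m f) else 0)"
      by (rule sum.cong) (auto simp: module_hom.zero[OF lin])
    then show ?thesis by simp
  qed
  ultimately show ?case by simp
next
  case (Suc k)
  define P where "P j = ops_power A j" for j
  have P: "P (Suc j) l f = (\<Sum>i\<le>l. A i (P j (l - i) f))" for j l
    by (simp add: P_def ops_mult_def)
  have IH: "pscale (of_nat l) (P (Suc k) l f) =
      pscale (of_nat (Suc k)) (\<Sum>i\<le>l. pscale (of_nat i) (A i (P k (l - i) f)))" for l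
    using Suc.IH by (simp add: P_def)
  have "pscale (of_nat m) (P (Suc (Suc k)) m f) =
      (\<Sum>i\<le>m. pscale (of_nat i) (A i (P (Suc k) (m - i) f))
             + A i (pscale (of_nat (m - i)) (P (Suc k) (m - i) f)))"
    by (simp add: P[of "Suc k"] poly.scale_sum_right module_hom.scale[OF lin] of_nat_diff
        flip: poly.scale_left_distrib)
  also have "\<dots> = (\<Sum>i\<le>m. pscale (of_nat i) (A i (P (Suc k) (m - i) f)))
      + pscale (of_nat (Suc k)) (\<Sum>i\<le>m. \<Sum>j\<le>m - i. pscale (of_nat j) (A i (A j (P k (m - i - j) f))))"
    by (simp only: IH sum.distrib module_hom.scale[OF lin] module_hom.sum[OF lin] poly.scale_sum_right)
  also have "(\<Sum>i\<le>m. \<Sum>j\<le>m - i. pscale (of_nat j) (A i (A j (P k (m - i - j) f))))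
      = (\<Sum>j\<le>m. pscale (of_nat j) (A j (P (Suc k) (m - j) f)))"
    by (subst sum_triangle_swap)
      (simp add: P[of k] comm[of _ _ "P _ _ _"] add.commute poly.scale_sum_right
        module_hom.sum[OF lin])
  finally have "pscale (of_nat m) (P (Suc (Suc k)) m f) =
      pscale (1 + of_nat (Suc k)) (\<Sum>j\<le>m. pscale (of_nat j) (A j (P (Suc k) (m - j) f)))"
    by (simp only: poly.scale_left_distrib poly.scale_one)
  then show ?case by (simp only: P_def of_nat_Suc)
qed

text \<open>This is \<open>u E' = u A' E\<close> for \<open>E = exp A\<close>; together with the constant term it determines \<open>E\<close>.\<close>

lemma euler_exp:
  "pscale (of_nat m) (ops_exp A m f) =
   (\<Sum>i\<le>m. pscale (of_nat i) (A i (ops_exp A (m - i) f)))"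
proof (cases m)
  case (Suc m')
  define P where "P = ops_power A"
  have "pscale (of_nat m) (ops_exp A m f) =
      (\<Sum>k\<le>m'. pscale (1 / fact (Suc k)) (pscale (of_nat m) (P (Suc k) m f)))"
    unfolding ops_exp_def Suc by (subst sum.atMost_Suc_shift)
      (simp add: P_def poly.scale_sum_right mult_ac poly.scale_right_distrib)
  also have "\<dots> = (\<Sum>k\<le>m'. pscale (1 / fact k)
      (\<Sum>i\<le>m. pscale (of_nat i) (A i (P k (m - i) f))))"
    unfolding P_def euler_power by (simp del: ops_power.simps of_nat_Suc add: divide_simps)
  also have "\<dots> = (\<Sum>i\<le>m. pscale (of_nat i) (A i (\<Sum>k\<le>m'. pscale (1 / fact k) (P k (m - i) f))))"
    by (simp add: poly.scale_sum_right module_hom.sum[OF lin] module_hom.scale[OF lin] mult_ac)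
      (rule sum.swap)
  also have "\<dots> = (\<Sum>i\<le>m. pscale (of_nat i) (A i (ops_exp A (m - i) f)))"
  proof (rule sum.cong[OF refl])
    fix i assume "i \<in> {..m}"
    then show "pscale (of_nat i) (A i (\<Sum>k\<le>m'. pscale (1 / fact k) (P k (m - i) f)))
      = pscale (of_nat i) (A i (ops_exp A (m - i) f))"
      using exp_upto[of "m - i" m' f] Suc by (cases "i = 0") (auto simp: P_def)
  qed
  finally show ?thesis .
qed (simp add: zero)

lemma exp_unique:
  assumes "G 0 = f"
    and "\<And>m. pscale (of_nat m) (G m) = (\<Sum>i\<le>m. pscale (of_nat i) (A i (G (m - i))))"
  shows "G m = ops_exp A m f"
proof (induction m rule: less_induct)
  case (less m)
  show ?case
  proof (cases "m = 0")
    case False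
    have "pscale (of_nat i) (A i (G (m - i))) = pscale (of_nat i) (A i (ops_exp A (m - i) f))"
      if "i \<le> m" for i
      using less[of "m - i"] that False by (cases "i = 0") auto
    then have "pscale (of_nat m) (G m) = pscale (of_nat m) (ops_exp A m f)"
      unfolding assms(2) euler_exp by (intro sum.cong) auto
    then show ?thesis using False by simp
  qed (simp add: assms(1) exp_0)
qed

text \<open>The product rule for the Euler operator on one factor of a Cauchy product.\<close>

lemma euler_conv:
  "(\<Sum>i\<le>m. pscale (of_nat i) (ops_exp A i (g (m - i)))) =
   (\<Sum>j\<le>m. pscale (of_nat j) (A j (\<Sum>i\<le>m - j. ops_exp A i (g (m - j - i)))))"
proof -
  have "(\<Sum>i\<le>m. pscale (of_nat i) (ops_exp A i (g (m - i)))) =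
      (\<Sum>i\<le>m. \<Sum>j\<le>i. pscale (of_nat j) (A j (ops_exp A (i - j) (g (m - (j + (i - j)))))))"
    by (simp add: euler_exp)
  also have "\<dots> = (\<Sum>j\<le>m. \<Sum>i\<le>m - j. pscale (of_nat j) (A j (ops_exp A i (g (m - (j + i))))))"
    by (rule sum_triangle_diag)
  finally show ?thesis
    by (simp add: module_hom.sum[OF lin] poly.scale_sum_right)
qed

end

text \<open>The Cauchy product of the exponentials solves the differential equation of the exponential of
  the sum.\<close>

lemma exp_add:
  assumes "commuting_series A" "commuting_series B"
    and AB: "\<And>i j f. A i (B j f) = B j (A i f)"
  shows "ops_exp (\<lambda>m f. A m f + B m f) m f = (\<Sum>i\<le>m. ops_exp A i (ops_exp B (m - i) f))"
proof -
  interpret A: commuting_series A by fact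
  interpret B: commuting_series B by fact
  interpret AB: commuting_series "\<lambda>m f. A m f + B m f"
    by unfold_locales
      (simp_all add: A.zero B.zero module_hom.add[OF A.lin] module_hom.add[OF B.lin]
        module_hom.scale[OF A.lin] module_hom.scale[OF B.lin] poly.scale_right_distrib
        A.comm B.comm AB add_ac A.comm[of _ _ f for f] B.comm[of _ _ f for f])
  define G where "G m = (\<Sum>i\<le>m. ops_exp A i (ops_exp B (m - i) f))" for m
  have "G m = ops_exp (\<lambda>m f. A m f + B m f) m f"
  proof (rule AB.exp_unique)
    show "G 0 = f" by (simp add: G_def A.exp_0 B.exp_0)
    fix m
    have "pscale (of_nat m) (G m) =
        (\<Sum>i\<le>m. pscale (of_nat i) (ops_exp A i (ops_exp B (m - i) f)))
        + (\<Sum>i\<le>m. ops_exp A i (pscale (of_nat (m - i)) (ops_exp B (m - i) f)))"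
      by (simp add: G_def poly.scale_sum_right module_hom.scale[OF A.lin_exp] of_nat_diff
          flip: poly.scale_left_distrib sum.distrib)
    also have "(\<Sum>i\<le>m. ops_exp A i (pscale (of_nat (m - i)) (ops_exp B (m - i) f)))
        = (\<Sum>i\<le>m. \<Sum>j\<le>m - i. pscale (of_nat j) (B j (ops_exp A i (ops_exp B (m - i - j) f))))"
      by (simp only: B.euler_exp module_hom.sum[OF A.lin_exp] module_hom.scale[OF A.lin_exp]
          A.exp_commute[OF B.lin AB])
    also have "\<dots> = (\<Sum>j\<le>m. pscale (of_nat j) (B j (G (m - j))))"
      by (subst sum_triangle_swap)
        (simp add: G_def module_hom.sum[OF B.lin] poly.scale_sum_right add.commute)
    also have "(\<Sum>i\<le>m. pscale (of_nat i) (ops_exp A i (ops_exp B (m - i) f)))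
        = (\<Sum>j\<le>m. pscale (of_nat j) (A j (G (m - j))))"
      unfolding G_def by (rule A.euler_conv)
    finally show "pscale (of_nat m) (G m) =
        (\<Sum>i\<le>m. pscale (of_nat i) (A i (G (m - i)) + B i (G (m - i))))"
      by (simp add: sum.distrib poly.scale_right_distrib)
  qed
  then show ?thesis by (simp add: G_def)
qed

text \<open>The substitution \<open>u \<mapsto> - u\<close>.\<close>

lemma exp_alternate:
  assumes "commuting_series A"
  shows "ops_exp (\<lambda>m f. pscale ((-1) ^ m) (A m f)) m f = pscale ((-1) ^ m) (ops_exp A m f)"
proof -
  interpret A: commuting_series A by fact
  interpret B: commuting_series "\<lambda>m f. pscale ((-1) ^ m) (A m f)"
    by unfold_locales
      (simp_all add: A.zero module_hom.add[OF A.lin]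
        module_hom.scale[OF A.lin] poly.scale_right_distrib A.comm mult_ac A.comm[of _ _ f for f])
  have "pscale ((-1) ^ m) (ops_exp A m f) = ops_exp (\<lambda>m f. pscale ((-1) ^ m) (A m f)) m f"
    by (rule B.exp_unique)
      (auto simp: A.exp_0 poly.scale_left_commute[of "of_nat _"] A.euler_exp poly.scale_sum_right
        module_hom.scale[OF A.lin] simp del: poly.scale_scale intro!: sum.cong,
        simp add: mult_ac flip: power_add)
  then show ?thesis by simp
qed

lemma exp_zero: "ops_exp (\<lambda>m f. 0) m f = (if m = 0 then f else 0)"
proof -
  interpret commuting_series "\<lambda>m f. 0"
    by unfold_locales auto
  show ?thesis by (rule exp_unique[symmetric]) auto
qed

text \<open>\<open>u E' E\<^sup>-\<^sup>1 = u A'\<close> for \<open>E = exp A\<close>.\<close>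

lemma euler_exp_inverse:
  assumes "commuting_series A" "commuting_series B"
    and AB: "\<And>i j f. A i (B j f) = B j (A i f)" and "\<And>i f. A i f + B i f = 0"
  shows "(\<Sum>i\<le>m. pscale (of_nat i) (ops_exp A i (ops_exp B (m - i) f))) = pscale (of_nat m) (A m f)"
proof -
  interpret A: commuting_series A by fact
  have inv: "(\<Sum>i\<le>l. ops_exp A i (ops_exp B (l - i) f)) = (if l = 0 then f else 0)" for l
    using exp_add[OF assms(1-3), of l f] by (simp add: assms(4) exp_zero)
  have "(\<Sum>i\<le>m. pscale (of_nat i) (ops_exp A i (ops_exp B (m - i) f))) =
      (\<Sum>j\<le>m. pscale (of_nat j) (A j (if m - j = 0 then f else 0)))"
    by (simp only: A.euler_conv[of "\<lambda>i. ops_exp B i f"] inv)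
  also have "\<dots> = (\<Sum>j\<le>m. if j = m then pscale (of_nat m) (A m f) else 0)"
    by (rule sum.cong) (auto simp: module_hom.zero[OF A.lin])
  finally show ?thesis by simp
qed


section \<open>Commuting two exponentials\<close>

text \<open>The Taylor coefficients of \<open>((1 - t) / (1 + t)) powr (s / 2)\<close>. The recursion is the differential
  equation \<open>(1 - t\<^sup>2) \<phi>' = - s \<phi>\<close>, so that arbitrary exponents need no separate treatment.\<close>

fun exchange_coeff :: "complex \<Rightarrow> nat \<Rightarrow> complex" where
  "exchange_coeff s 0 = 1"
| "exchange_coeff s (Suc 0) = - s"
| "exchange_coeff s (Suc (Suc p)) =
     (of_nat p * exchange_coeff s p - s * exchange_coeff s (Suc p)) / of_nat (p + 2)"

text \<open>The same differential equation in the form \<open>t \<phi>' = - s (t / (1 - t\<^sup>2)) \<phi>\<close>, which is how it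
  arises in the exchange of two exponentials.\<close>

lemma euler_exchange_coeff:
  "of_nat p * exchange_coeff s p = - s * (\<Sum>i\<le>p. if odd i then exchange_coeff s (p - i) else 0)"
proof (induction p rule: induct_nat_012)
  case 0
  show ?case by simp
next
  case 1
  show ?case by simp
next
  case (ge2 p)
  have "(\<Sum>i\<le>Suc (Suc p). if odd i then exchange_coeff s (Suc (Suc p) - i) else 0)
      = exchange_coeff s (Suc p) + (\<Sum>i\<le>p. if odd i then exchange_coeff s (p - i) else 0)"
    by (subst sum.atMost_Suc_shift, subst sum.atMost_Suc_shift) (simp cong: if_cong)
  moreover have "of_nat (Suc (Suc p)) * exchange_coeff s (Suc (Suc p))
      = of_nat p * exchange_coeff s p - s * exchange_coeff s (Suc p)"
    by (simp del: of_nat_Suc add: divide_simps)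
  ultimately show ?case by (simp only: ge2(1)) (simp only: distrib_left diff_conv_add_uminus mult_minus_left add.commute)
qed

text \<open>An operator whose commutators with all \<open>A\<^sub>k\<close> are scalars acts on \<open>exp A\<close> like a derivation, here
  \<open>[T, exp A(w)] = - (s / i) w\<^sup>i exp A(w)\<close>.\<close>

lemma annihilator_exp:
  assumes "commuting_series A" "lin T"
    and TA: "\<And>k f. T (A k f) = A k (T f) - (if k = i then pscale (s / of_nat i) f else 0)"
    and "i \<noteq> 0"
  shows "T (ops_exp A m f) =
    ops_exp A m (T f) - (if i \<le> m then pscale (s / of_nat i) (ops_exp A (m - i) f) else 0)"
proof (induction m rule: less_induct)
  case (less m)
  interpret A: commuting_series A by fact
  note T = module_hom.sum[OF assms(2)] module_hom.scale[OF assms(2)]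
  show ?case
  proof (cases "m = 0")
    case True
    then show ?thesis using \<open>i \<noteq> 0\<close> by (simp add: A.exp_0)
  next
    case False
    define R where "R l = (if i \<le> l then pscale (s / of_nat i) (ops_exp A (l - i) f) else 0)" for l
    have IH: "pscale (of_nat k) (A k (T (ops_exp A (m - k) f)))
        = pscale (of_nat k) (A k (ops_exp A (m - k) (T f))) - pscale (of_nat k) (A k (R (m - k)))"
      if "k \<le> m" for k
      using less[of "m - k"] that False
      by (cases "k = 0") (auto simp: R_def module_hom.diff[OF A.lin] poly.scale_right_diff_distrib)
    have "pscale (of_nat m) (T (ops_exp A m f)) = T (pscale (of_nat m) (ops_exp A m f))"
      by (simp add: T)
    also have "\<dots> = (\<Sum>k\<le>m. pscale (of_nat k) (A k (T (ops_exp A (m - k) f)))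
        - (if k = i then pscale s (ops_exp A (m - i) f) else 0))"
      unfolding A.euler_exp T TA using \<open>i \<noteq> 0\<close>
      by (intro sum.cong) (auto simp: poly.scale_right_diff_distrib)
    also have "\<dots> = (\<Sum>k\<le>m. pscale (of_nat k) (A k (T (ops_exp A (m - k) f))))
        - (if i \<le> m then pscale s (ops_exp A (m - i) f) else 0)"
      by (simp add: sum_subtractf)
    also have "(\<Sum>k\<le>m. pscale (of_nat k) (A k (T (ops_exp A (m - k) f))))
        = pscale (of_nat m) (ops_exp A m (T f)) - (\<Sum>k\<le>m. pscale (of_nat k) (A k (R (m - k))))"
      by (simp add: IH sum_subtractf A.euler_exp)
    also have "(\<Sum>k\<le>m. pscale (of_nat k) (A k (R (m - k)))) = pscale (of_nat (m - i)) (R m)"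
    proof (cases "i \<le> m")
      case True
      have "(\<Sum>k\<le>m. pscale (of_nat k) (A k (R (m - k))))
          = (\<Sum>k\<le>m - i. pscale (of_nat k) (A k (R (m - k))))"
        by (rule sum.mono_neutral_right) (auto simp: R_def module_hom.zero[OF A.lin])
      also have "\<dots> = (\<Sum>k\<le>m - i. pscale (of_nat k) (A k (pscale (s / of_nat i) (ops_exp A (m - i - k) f))))"
        using True by (intro sum.cong) (auto simp: R_def add.commute)
      also have "\<dots> = pscale (s / of_nat i) (pscale (of_nat (m - i)) (ops_exp A (m - i) f))"
        by (simp add: A.euler_exp poly.scale_sum_right module_hom.scale[OF A.lin] mult_ac
            del: of_nat_diff)
      finally show ?thesis using True by (simp add: R_def mult_ac)
    next
      case False
      then have "R (m - k) = 0" if "k \<le> m" for k by (auto simp: R_def)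
      then have "(\<Sum>k\<le>m. pscale (of_nat k) (A k (R (m - k)))) = 0"
        by (simp add: module_hom.zero[OF A.lin])
      with False show ?thesis by (simp add: R_def)
    qed
    also have "(if i \<le> m then pscale s (ops_exp A (m - i) f) else 0) = pscale (of_nat i) (R m)"
      using \<open>i \<noteq> 0\<close> by (simp add: R_def)
    also have "pscale (of_nat m) (ops_exp A m (T f)) - pscale (of_nat (m - i)) (R m)
        - pscale (of_nat i) (R m) = pscale (of_nat m) (ops_exp A m (T f) - R m)"
    proof (cases "i \<le> m")
      case True
      then have "of_nat m = of_nat (m - i) + (of_nat i :: complex)" by simp
      then have "pscale (of_nat m) (R m) = pscale (of_nat (m - i)) (R m) + pscale (of_nat i) (R m)"
        by (metis poly.scale_left_distrib)
      then show ?thesis by (simp add: poly.scale_right_diff_distrib)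
    qed (simp add: R_def)
    finally have "pscale (of_nat m) (T (ops_exp A m f)) = pscale (of_nat m) (ops_exp A m (T f) - R m)" .
    then show ?thesis using False by (simp add: R_def)
  qed
qed

text \<open>In generating functions: \<open>exp B(t) exp A(w) = \<phi>(t w) exp A(w) exp B(t)\<close>. The right-hand side
  satisfies the differential equation of \<open>exp B\<close>: the commutators of \<open>B\<^sub>i\<close> with \<open>exp A\<close> contribute
  \<open>- s (\<Sum>i odd. (t w)\<^sup>i)\<close>, which is the logarithmic derivative of \<open>\<phi>\<close>.\<close>

lemma exp_exchange:
  assumes "commuting_series A" "commuting_series B"
    and BA: "\<And>i k f. B i (A k f) =
      A k (B i f) - (if odd i \<and> k = i then pscale (s / of_nat i) f else 0)"
  shows "ops_exp B l (ops_exp A m f) =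
    (\<Sum>i\<le>l. if i \<le> m then pscale (exchange_coeff s i) (ops_exp A (m - i) (ops_exp B (l - i) f)) else 0)"
proof -
  interpret A: commuting_series A by fact
  interpret B: commuting_series B by fact
  define E where "E k g = (if k \<ge> (0::int) then ops_exp A (nat k) g else 0)" for k g
  have lin_E: "lin (E k)" for k
    by (cases "k \<ge> 0") (simp_all add: E_def[abs_def] A.lin_exp lin_const_0)
  note linE = module_hom.sum[OF lin_E] module_hom.scale[OF lin_E]
  have BE: "B i (E k g) = E k (B i g) - (if odd i then pscale (s / of_nat i) (E (k - int i) g) else 0)"
    for i k g
  proof (cases "odd i")
    case True
    then have "i \<noteq> 0" by (auto intro: ccontr)
    have "B i (ops_exp A p g) = ops_exp A p (B i g) -
        (if i \<le> p then pscale (s / of_nat i) (ops_exp A (p - i) g) else 0)" for p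
      by (rule annihilator_exp[OF assms(1) B.lin _ \<open>i \<noteq> 0\<close>]) (use BA True in auto)
    moreover have "nat (k - int i) = nat k - i" "k \<ge> 0 \<Longrightarrow> i \<le> nat k \<longleftrightarrow> int i \<le> k" by auto
    ultimately show ?thesis using True by (auto simp: E_def module_hom.zero[OF B.lin])
  next
    case False
    have "ops_exp A p (B i g) = B i (ops_exp A p g)" for p
      by (rule A.exp_commute[OF B.lin]) (use BA False in auto)
    then show ?thesis using False by (auto simp: E_def module_hom.zero[OF B.lin])
  qed
  \<comment> \<open>Integer indices make the summands vanish by themselves when \<open>i > k\<close>.\<close>
  have "(\<Sum>i\<le>l. pscale (exchange_coeff s i) (E (k - int i) (ops_exp B (l - i) f)))
      = ops_exp B l (E k f)" for k
  proof (rule B.exp_unique)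
    show "(\<Sum>i\<le>0. pscale (exchange_coeff s i) (E (k - int i) (ops_exp B (0 - i) f))) = E k f"
      by (simp add: B.exp_0)
    fix l
    define G where "G l = (\<Sum>i\<le>l. pscale (exchange_coeff s i) (E (k - int i) (ops_exp B (l - i) f)))" for l
    let ?D = "\<lambda>p. E (k - int p) (ops_exp B (l - p) f)"
    have "(\<Sum>i\<le>l. pscale (of_nat i) (B i (G (l - i))))
        = (\<Sum>i\<le>l. \<Sum>p\<le>l - i. pscale (exchange_coeff s p)
            (E (k - int p) (pscale (of_nat i) (B i (ops_exp B (l - p - i) f)))))
          - (\<Sum>i\<le>l. \<Sum>p\<le>l - i. if odd i then pscale (s * exchange_coeff s (p + i - i)) (?D (p + i)) else 0)"
      unfolding G_def sum_subtractf[symmetric]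
    proof (intro sum.cong refl)
      fix i p assume "i \<in> {..l}"
      have "pscale (of_nat i) (B i (pscale (exchange_coeff s p) (E (k - int p) (ops_exp B (l - i - p) f))))
        = pscale (exchange_coeff s p) (E (k - int p) (pscale (of_nat i) (B i (ops_exp B (l - p - i) f))))
          - (if odd i then pscale (s * exchange_coeff s (p + i - i)) (?D (p + i)) else 0)" for p
        by (cases "i = 0") (auto simp: BE linE module_hom.zero[OF lin_E] module_hom.scale[OF B.lin] poly.scale_right_diff_distrib
            mult_ac add_ac algebra_simps)
      then show "pscale (of_nat i) (B i (\<Sum>p\<le>l - i. pscale (exchange_coeff s p) (E (k - int p) (ops_exp B (l - i - p) f))))
        = (\<Sum>p\<le>l - i. pscale (exchange_coeff s p) (E (k - int p) (pscale (of_nat i) (B i (ops_exp B (l - p - i) f))))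
          - (if odd i then pscale (s * exchange_coeff s (p + i - i)) (?D (p + i)) else 0))"
        by (simp only: module_hom.sum[OF B.lin] poly.scale_sum_right)
    qed
    also have "(\<Sum>i\<le>l. \<Sum>p\<le>l - i. pscale (exchange_coeff s p)
            (E (k - int p) (pscale (of_nat i) (B i (ops_exp B (l - p - i) f)))))
        = (\<Sum>p\<le>l. pscale (exchange_coeff s p) (E (k - int p) (pscale (of_nat (l - p)) (ops_exp B (l - p) f))))"
      by (subst sum_triangle_swap) (simp only: B.euler_exp linE poly.scale_sum_right)
    also have "(\<Sum>i\<le>l. \<Sum>p\<le>l - i. if odd i then pscale (s * exchange_coeff s (p + i - i)) (?D (p + i)) else 0)
        = (\<Sum>q\<le>l. \<Sum>i\<le>q. if odd i then pscale (s * exchange_coeff s (q - i)) (?D q) else 0)"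
      unfolding sum_triangle_diag[of "\<lambda>i p. if odd i then pscale (s * exchange_coeff s (p + i - i)) (?D (p + i)) else 0" l, symmetric]
      by (intro sum.cong) auto
    also have "\<dots> = (\<Sum>q\<le>l. pscale (- of_nat q * exchange_coeff s q) (?D q))"
    proof (rule sum.cong[OF refl])
      fix q
      have "(\<Sum>i\<le>q. if odd i then pscale (s * exchange_coeff s (q - i)) (?D q) else 0)
        = pscale (\<Sum>i\<le>q. if odd i then s * exchange_coeff s (q - i) else 0) (?D q)"
        by (simp add: poly.scale_sum_left if_distrib[where f = "\<lambda>c. pscale c (?D q)"] cong: if_cong)
      also have "(\<Sum>i\<le>q. if odd i then s * exchange_coeff s (q - i) else 0) = - of_nat q * exchange_coeff s q"
        using euler_exchange_coeff[of q s] by (simp add: sum_distrib_left if_distrib[where f = "(*) s"] sum_negf cong: if_cong)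
      finally show "(\<Sum>i\<le>q. if odd i then pscale (s * exchange_coeff s (q - i)) (?D q) else 0)
        = pscale (- of_nat q * exchange_coeff s q) (?D q)" .
    qed
    also have "(\<Sum>p\<le>l. pscale (exchange_coeff s p) (E (k - int p) (pscale (of_nat (l - p)) (ops_exp B (l - p) f))))
        - (\<Sum>q\<le>l. pscale (- of_nat q * exchange_coeff s q) (?D q)) = pscale (of_nat l) (G l)"
      by (simp add: G_def poly.scale_sum_right linE algebra_simps flip: sum_subtractf poly.scale_left_diff_distrib poly.scale_left_distrib)
    finally show "pscale (of_nat l) (\<Sum>i\<le>l. pscale (exchange_coeff s i) (E (k - int i) (ops_exp B (l - i) f)))
        = (\<Sum>i\<le>l. pscale (of_nat i) (B i (\<Sum>p\<le>l - i. pscale (exchange_coeff s p) (E (k - int p) (ops_exp B (l - i - p) f)))))"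
      by (simp add: G_def)
  qed
  from this[of "int m"] show ?thesis
    by (simp add: E_def nat_diff_distrib if_distrib[where f = "pscale _"] cong: if_cong)
qed


section \<open>Creation and annihilation operators\<close>

lemma lookup_pdiff:
  "Poly_Mapping.lookup (pdiff j r f) m =
     of_nat (Poly_Mapping.lookup m (j, r) + 1) * Poly_Mapping.lookup f (m + Poly_Mapping.single (j, r) 1)"
proof -
  let ?e = "Poly_Mapping.single (j, r) (1::nat)"
  have inv: "m' - ?e + ?e = m'" if "Poly_Mapping.lookup m' (j, r) \<noteq> 0" for m'
    using that by (intro poly_mapping_eqI) (auto simp: lookup_add lookup_minus lookup_single when_def)
  have "Poly_Mapping.lookup (pdiff j r f) m = (\<Sum>m'\<in>Poly_Mapping.keys f.
      if m' = m + ?e then of_nat (Poly_Mapping.lookup m' (j, r)) * Poly_Mapping.lookup f m' else 0)"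
    unfolding pdiff_def lookup_sum
  proof (rule sum.cong[OF refl])
    fix m'
    show "Poly_Mapping.lookup (Poly_Mapping.single (m' - ?e)
        (of_nat (Poly_Mapping.lookup m' (j, r)) * Poly_Mapping.lookup f m')) m
      = (if m' = m + ?e then of_nat (Poly_Mapping.lookup m' (j, r)) * Poly_Mapping.lookup f m' else 0)"
      using inv[of m'] by (cases "Poly_Mapping.lookup m' (j, r) = 0") (auto simp: lookup_single when_def lookup_add)
  qed
  also have "\<dots> = of_nat (Poly_Mapping.lookup m (j, r) + 1) * Poly_Mapping.lookup f (m + ?e)"
    by (simp add: lookup_add in_keys_iff)
  finally show ?thesis .
qed

lemma lookup_pvar_mult:
  "Poly_Mapping.lookup (pvar j r * f) m =
     (if Poly_Mapping.lookup m (j, r) = 0 then 0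
      else Poly_Mapping.lookup f (m - Poly_Mapping.single (j, r) 1))"
proof -
  let ?e = "Poly_Mapping.single (j, r) (1::nat)"
  have inv: "m = ?e + l \<longleftrightarrow> Poly_Mapping.lookup m (j, r) \<noteq> 0 \<and> l = m - ?e" for l
  proof
    assume r: "Poly_Mapping.lookup m (j, r) \<noteq> 0 \<and> l = m - ?e"
    then show "m = ?e + l"
      by (intro poly_mapping_eqI) (auto simp: lookup_add lookup_minus lookup_single when_def)
  qed (auto simp: lookup_add)
  have "Poly_Mapping.lookup (pvar j r * f) m = Sum_any (\<lambda>l. Poly_Mapping.lookup f l when m = ?e + l)"
    by (simp add: lookup_mult pvar_def lookup_single when_mult)
  also have "\<dots> = (if Poly_Mapping.lookup m (j, r) = 0 then 0 else Poly_Mapping.lookup f (m - ?e))"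
    unfolding inv by (cases "Poly_Mapping.lookup m (j, r) = 0") simp_all
  finally show ?thesis .
qed

lemma lin_pdiff: "lin (pdiff j r)"
  by (rule linI; rule poly_mapping_eqI) (simp_all add: lookup_pdiff lookup_add algebra_simps)

lemma pdiff_commute: "pdiff i r (pdiff j q f) = pdiff j q (pdiff i r f)"
  by (rule poly_mapping_eqI) (simp add: lookup_pdiff lookup_add lookup_single when_def algebra_simps)

lemma pdiff_pvar_mult:
  "pdiff i r (pvar j q * f) = pvar j q * pdiff i r f + (if i = j \<and> r = q then f else 0)"
proof (rule poly_mapping_eqI)
  fix m
  let ?e = "Poly_Mapping.single (i, r) (1::nat)" and ?e' = "Poly_Mapping.single (j, q) (1::nat)"
  have *: "m + ?e - ?e' = m - ?e' + ?e" if "(i, r) \<noteq> (j, q) \<or> Poly_Mapping.lookup m (j, q) \<noteq> 0"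
    using that by (intro poly_mapping_eqI) (auto simp: lookup_add lookup_minus lookup_single when_def)
  have **: "m - ?e + ?e = m" if "Poly_Mapping.lookup m (i, r) \<noteq> 0"
    using that by (intro poly_mapping_eqI) (auto simp: lookup_add lookup_minus lookup_single when_def)
  show "Poly_Mapping.lookup (pdiff i r (pvar j q * f)) m =
    Poly_Mapping.lookup (pvar j q * pdiff i r f + (if i = j \<and> r = q then f else 0)) m"
    using * **
    by (cases "i = j \<and> r = q"; cases "Poly_Mapping.lookup m (j, q) = 0")
      (auto simp: lookup_pdiff lookup_pvar_mult lookup_add lookup_minus lookup_single when_def distrib_right)
qed

lemma creation_commute: "creation n lam i (creation n mu j f) = creation n mu j (creation n lam i f)"
proof (cases "odd i \<and> odd j")
  case True
  then have "creation n lam i (creation n mu j f) =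
      (\<Sum>a=1..n. \<Sum>b=1..n. pscale (lam a * mu b) (pvar a i * (pvar b j * f)))"
    by (simp add: creation_def sum_distrib_left pscale_mult_right poly.scale_sum_right)
  also have "\<dots> = (\<Sum>b=1..n. \<Sum>a=1..n. pscale (mu b * lam a) (pvar b j * (pvar a i * f)))"
    by (subst sum.swap) (simp add: mult_ac)
  also have "\<dots> = creation n mu j (creation n lam i f)"
    using True by (simp add: creation_def sum_distrib_left pscale_mult_right poly.scale_sum_right)
  finally show ?thesis .
qed (auto simp: creation_def)

lemma annihilation_commute:
  "annihilation n lam i (annihilation n mu j f) = annihilation n mu j (annihilation n lam i f)"
proof (cases "odd i \<and> odd j")
  case True
  note lin = module_hom.sum[OF lin_pdiff] module_hom.scale[OF lin_pdiff]
  have "annihilation n lam i (annihilation n mu j f) =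
      (\<Sum>a=1..n. \<Sum>b=1..n. pscale (- lam a / of_nat i) (pscale (- mu b / of_nat j) (pdiff a i (pdiff b j f))))"
    using True by (simp only: annihilation_def lin poly.scale_sum_right if_True simp_thms)
  also have "\<dots> = (\<Sum>b=1..n. \<Sum>a=1..n. pscale (- mu b / of_nat j) (pscale (- lam a / of_nat i) (pdiff b j (pdiff a i f))))"
    by (subst sum.swap) (simp only: poly.scale_left_commute[of "- lam _ / _"] pdiff_commute[of _ i])
  also have "\<dots> = annihilation n mu j (annihilation n lam i f)"
    using True by (simp only: annihilation_def lin poly.scale_sum_right if_True simp_thms)
  finally show ?thesis .
qed (auto simp: annihilation_def module_hom.zero[OF lin_pdiff])

lemma commuting_creation: "commuting_series (creation n lam)"
proof (rule commuting_series.intro)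
  fix m show "lin (creation n lam m)"
    unfolding creation_def[abs_def] by (cases "odd m") (auto intro!: lin_intros)
qed (rule creation_commute | simp add: creation_def)+

lemma commuting_annihilation: "commuting_series (annihilation n lam)"
proof (rule commuting_series.intro)
  fix m show "lin (annihilation n lam m)"
    by (cases "odd m")
      (auto simp only: annihilation_def[abs_def] not_False_eq_True if_True if_False
        intro!: lin_sum lin_pscale lin_pdiff lin_const_0)
qed (rule annihilation_commute | simp add: annihilation_def)+

text \<open>The Heisenberg relation \<open>[\<partial>/\<partial>x, x] = 1\<close>, for linear combinations.\<close>

lemma annihilation_creation:
  "annihilation n lam i (creation n mu k f) =
   creation n mu k (annihilation n lam i f)
   - (if odd i \<and> k = i then pscale ((\<Sum>j=1..n. lam j * mu j) / of_nat i) f else 0)"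
proof (cases "odd i \<and> odd k")
  case True
  have *: "pscale c (pscale (mu l) (pdiff j i (pvar l k * f))) = pscale (mu l) (pvar l k * pscale c (pdiff j i f))
      + (if l = j then if k = i then pscale (c * mu j) f else 0 else 0)" for c j l
    by (simp add: pdiff_pvar_mult poly.scale_right_distrib pscale_mult_right mult.commute[of c])
  have "annihilation n lam i (creation n mu k f) =
      (\<Sum>j=1..n. \<Sum>l=1..n. pscale (- lam j / of_nat i) (pscale (mu l) (pdiff j i (pvar l k * f))))"
    using True by (simp add: annihilation_def creation_def module_hom.sum[OF lin_pdiff]
        module_hom.scale[OF lin_pdiff] poly.scale_sum_right)
  also have "\<dots> = (\<Sum>j=1..n. \<Sum>l=1..n. pscale (mu l) (pvar l k * pscale (- lam j / of_nat i) (pdiff j i f)))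
      + (\<Sum>j=1..n. \<Sum>l=1..n. if l = j then if k = i then pscale (- lam j / of_nat i * mu j) f else 0 else 0)"
    by (simp only: * sum.distrib)
  also have "(\<Sum>j=1..n. \<Sum>l=1..n. pscale (mu l) (pvar l k * pscale (- lam j / of_nat i) (pdiff j i f)))
      = creation n mu k (annihilation n lam i f)"
    using True by (subst sum.swap) (simp add: annihilation_def creation_def sum_distrib_left poly.scale_sum_right)
  also have "(\<Sum>j=1..n. \<Sum>l=1..n. if l = j then if k = i then pscale (- lam j / of_nat i * mu j) f else 0 else 0)
      = - (if k = i then pscale ((\<Sum>j=1..n. lam j * mu j) / of_nat i) f else 0)"
    by (auto simp: poly.scale_sum_left sum_divide_distrib sum_negf)
  finally show ?thesis using True by simp
next
  case False
  then show ?thesis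
    by (auto simp: creation_def annihilation_def module_hom.zero[OF lin_pdiff])
qed

lemma creation_add: "creation n (\<lambda>j. lam j + mu j) = (\<lambda>m f. creation n lam m f + creation n mu m f)"
  by (intro ext) (simp add: creation_def poly.scale_left_distrib sum.distrib)

lemma annihilation_add:
  "annihilation n (\<lambda>j. lam j + mu j) = (\<lambda>m f. annihilation n lam m f + annihilation n mu m f)"
  by (intro ext)
    (simp add: annihilation_def diff_divide_distrib poly.scale_left_distrib poly.scale_left_diff_distrib
      sum.distrib sum_subtractf sum_negf)

lemma creation_uminus: "creation n (\<lambda>j. - lam j) = (\<lambda>m f. pscale ((-1) ^ m) (creation n lam m f))"
  by (intro ext) (simp add: creation_def sum_negf)

lemma annihilation_uminus:
  "annihilation n (\<lambda>j. - lam j) = (\<lambda>m f. pscale ((-1) ^ m) (annihilation n lam m f))"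
  by (intro ext) (simp add: annihilation_def sum_negf)

lemma creation_zero: "creation n (\<lambda>j. 0) = (\<lambda>m f. 0)"
  by (intro ext) (simp add: creation_def)

lemma annihilation_zero: "annihilation n (\<lambda>j. 0) = (\<lambda>m f. 0)"
  by (intro ext) (simp add: annihilation_def)


section \<open>Weights of polynomials\<close>

text \<open>The variable with index \<open>(j, r)\<close> has weight \<open>r\<close>, the degree in \<open>z\<close> with which it occurs in
  \<open>U\<^sub>\<lambda>(z)\<close>.\<close>

definition mweight :: "(nat \<times> nat \<Rightarrow>\<^sub>0 nat) \<Rightarrow> nat" where
  "mweight m = (\<Sum>p\<in>Poly_Mapping.keys m. snd p * Poly_Mapping.lookup m p)"

text \<open>The bound is an integer, so that subtracting the degree of an operator cannot be truncated; a
  negative bound forces the polynomial to vanish.\<close>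

definition weight_le :: "int \<Rightarrow> xpoly \<Rightarrow> bool" where
  "weight_le L f \<longleftrightarrow> (\<forall>m\<in>Poly_Mapping.keys f. int (mweight m) \<le> L)"

definition wdeg :: "xpoly \<Rightarrow> nat" where
  "wdeg f = Max (insert 0 (mweight ` Poly_Mapping.keys f))"

lemma weight_le_wdeg: "weight_le (int (wdeg f)) f"
  by (auto simp: weight_le_def wdeg_def)

lemma weight_le_imp_0: "weight_le L f \<Longrightarrow> L < 0 \<Longrightarrow> f = 0"
  by (rule poly_mapping_eqI) (force simp: weight_le_def in_keys_iff)

lemma weight_le_zero: "weight_le L 0"
  by (simp add: weight_le_def)

lemma weight_le_add: "weight_le L f \<Longrightarrow> weight_le L g \<Longrightarrow> weight_le L (f + g)"
  using keys_add[of f g] by (auto simp: weight_le_def)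

lemma weight_le_sum: "(\<And>i. i \<in> I \<Longrightarrow> weight_le L (f i)) \<Longrightarrow> weight_le L (\<Sum>i\<in>I. f i)"
  by (induction I rule: infinite_finite_induct) (auto simp: weight_le_zero weight_le_add)

lemma weight_le_pscale: "weight_le L f \<Longrightarrow> weight_le L (pscale c f)"
  by (auto simp: weight_le_def in_keys_iff)

lemma mweight_add: "mweight (m + m') = mweight m + mweight m'"
  unfolding mweight_def
  by (rule setsum_keys_plus_distrib[where f = "\<lambda>p x. snd p * x"]) (simp_all add: distrib_left)

lemma weight_le_pdiff:
  assumes "weight_le L f"
  shows "weight_le (L - int r) (pdiff j r f)"
  unfolding weight_le_def
proof
  fix m assume "m \<in> Poly_Mapping.keys (pdiff j r f)"
  then have "m + Poly_Mapping.single (j, r) 1 \<in> Poly_Mapping.keys f"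
    by (simp add: in_keys_iff lookup_pdiff)
  then have "int (mweight (m + Poly_Mapping.single (j, r) 1)) \<le> L"
    using assms unfolding weight_le_def by blast
  then show "int (mweight m) \<le> L - int r"
    by (simp add: mweight_add) (simp add: mweight_def)
qed

lemma weight_le_annihilation: "weight_le L f \<Longrightarrow> weight_le (L - int r) (annihilation n lam r f)"
  by (cases "odd r")
    (auto simp only: annihilation_def if_True if_False not_False_eq_True
      intro!: weight_le_zero weight_le_sum weight_le_pscale weight_le_pdiff)

lemma weight_le_exp_annihilation:
  assumes "weight_le L f"
  shows "weight_le (L - int m) (ops_exp (annihilation n lam) m f)"
proof -
  have "weight_le (L - int m) (ops_power (annihilation n lam) k m f)" for k
  proof (induction k arbitrary: m)
    case (Suc k)
    have "weight_le (L - int m) (annihilation n lam i (ops_power (annihilation n lam) k (m - i) f))"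
      if "i \<le> m" for i
      using weight_le_annihilation[OF Suc.IH[of "m - i"], of i n lam] that by (simp add: of_nat_diff)
    then show ?case by (auto simp: ops_mult_def intro!: weight_le_sum)
  qed (simp add: assms weight_le_zero)
  then show ?thesis by (auto simp: ops_exp_def intro!: weight_le_sum weight_le_pscale)
qed


section \<open>Products of vertex operators\<close>

text \<open>The coefficients of \<open>exp (\<Sum>\<lambda>\<^sub>j x\<^sub>r\<^sup>(\<^sup>j\<^sup>) z\<^sup>r)\<close>, extended by zero to negative exponents of \<open>z\<close>, so that
  exponents can be shifted freely.\<close>

definition cre :: "nat \<Rightarrow> (nat \<Rightarrow> complex) \<Rightarrow> int \<Rightarrow> xpoly" where
  "cre n lam k = (if k \<ge> 0 then ops_exp (creation n lam) (nat k) 1 else 0)"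

abbreviation ann :: "nat \<Rightarrow> (nat \<Rightarrow> complex) \<Rightarrow> opseries" where
  "ann n lam \<equiv> ops_exp (annihilation n lam)"

lemma cre_neg: "k < 0 \<Longrightarrow> cre n lam k = 0"
  by (simp add: cre_def)

text \<open>Multiplication operators commute with the creation operators, so the exponential is determined by
  its value at 1.\<close>

lemma exp_creation: "ops_exp (creation n lam) m f = cre n lam (int m) * f"
proof -
  interpret commuting_series "creation n lam" by (rule commuting_creation)
  have "ops_exp (creation n lam) m (f * 1) = f * ops_exp (creation n lam) m 1"
    by (rule exp_commute[OF lin_mult])
      (simp add: creation_def sum_distrib_left pscale_mult_right mult_ac)
  then show ?thesis by (simp add: cre_def mult.commute)
qed

lemma lin_ann: "lin (ann n lam l)"
  by (rule commuting_series.lin_exp[OF commuting_annihilation])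

lemmas ann_linear = module_hom.sum[OF lin_ann] module_hom.scale[OF lin_ann]
  module_hom.zero[OF lin_ann] module_hom.add[OF lin_ann]

lemma ann_commute: "ann n lam l (ann n mu p f) = ann n mu p (ann n lam l f)"
  by (rule commuting_series.exp_commute[OF commuting_annihilation lin_ann],
      rule commuting_series.exp_commute[OF commuting_annihilation
        commuting_series.lin[OF commuting_annihilation], symmetric],
      rule annihilation_commute)

lemma ann_eq_0: "weight_le L f \<Longrightarrow> int l > L \<Longrightarrow> ann n lam l f = 0"
  by (rule weight_le_imp_0[OF weight_le_exp_annihilation]) auto

lemma ann_ann_eq_0: "l + p > wdeg f \<Longrightarrow> ann n lam l (ann n mu p f) = 0"
  by (rule weight_le_imp_0[OF weight_le_exp_annihilation[OF weight_le_exp_annihilation[OF weight_le_wdeg]]])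
    simp

lemma ann_cre:
  assumes "s = (\<Sum>j=1..n. lam j * mu j)"
  shows "ann n lam l (cre n mu k * f) =
    (\<Sum>i\<le>l. pscale (exchange_coeff s i) (cre n mu (k - int i) * ann n lam (l - i) f))"
proof (cases "k \<ge> 0")
  case True
  have "ann n lam l (ops_exp (creation n mu) (nat k) f) = (\<Sum>i\<le>l. if i \<le> nat k
      then pscale (exchange_coeff s i) (ops_exp (creation n mu) (nat k - i) (ann n lam (l - i) f)) else 0)"
    by (rule exp_exchange[OF commuting_creation commuting_annihilation])
      (simp add: annihilation_creation assms)
  also have "\<dots> = (\<Sum>i\<le>l. pscale (exchange_coeff s i) (cre n mu (k - int i) * ann n lam (l - i) f))"
    using True by (intro sum.cong) (auto simp: exp_creation cre_neg of_nat_diff)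
  finally show ?thesis using True by (simp add: exp_creation)
qed (simp add: cre_neg ann_linear)

lemma Uop_eq_sum:
  assumes "\<And>l. l > L \<Longrightarrow> ann n lam l f = 0"
  shows "Uop n lam m f = (\<Sum>l\<le>L. cre n lam (m + int l) * ann n lam l f)"
proof -
  have "Uop n lam m f = Sum_any (\<lambda>l. cre n lam (m + int l) * ann n lam l f)"
    unfolding Uop_def by (rule Sum_any.cong) (simp add: exp_creation cre_neg)
  also have "\<dots> = (\<Sum>l\<le>L. cre n lam (m + int l) * ann n lam l f)"
    using assms by (intro Sum_any.expand_superset) (auto simp: not_less[symmetric])
  finally show ?thesis .
qed

lemma Uop_eq_sum_wdeg: "Uop n lam m f = (\<Sum>l\<le>wdeg f. cre n lam (m + int l) * ann n lam l f)"
  by (rule Uop_eq_sum, rule ann_eq_0[OF weight_le_wdeg]) simp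

text \<open>The coefficient of \<open>z\<^sup>a w\<^sup>b\<close> in \<open>: U\<^sub>\<lambda>(z) U\<^sub>\<mu>(w) :\<close>, in which all derivatives act before the
  multiplications. Here \<open>q\<close> is the total degree of the derivatives; terms with \<open>q > wdeg f\<close> vanish.\<close>

definition normal_product ::
    "nat \<Rightarrow> (nat \<Rightarrow> complex) \<Rightarrow> (nat \<Rightarrow> complex) \<Rightarrow> int \<Rightarrow> int \<Rightarrow> xpoly \<Rightarrow> xpoly" where
  "normal_product n lam mu a b f = (\<Sum>q\<le>wdeg f. \<Sum>l\<le>q.
     cre n lam (a + int l) * cre n mu (b + int (q - l)) * ann n lam l (ann n mu (q - l) f))"

lemma normal_product_eq_0: "b < - int (wdeg f) \<Longrightarrow> normal_product n lam mu a b f = 0"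
  by (auto simp: normal_product_def cre_neg)

lemma normal_product_swap: "normal_product n mu lam b a f = normal_product n lam mu a b f"
  unfolding normal_product_def
proof (rule sum.cong[OF refl])
  fix q
  show "(\<Sum>l\<le>q. cre n mu (b + int l) * cre n lam (a + int (q - l)) * ann n mu l (ann n lam (q - l) f)) =
        (\<Sum>l\<le>q. cre n lam (a + int l) * cre n mu (b + int (q - l)) * ann n lam l (ann n mu (q - l) f))"
    by (rule sum.reindex_bij_witness[of _ "\<lambda>l. q - l" "\<lambda>l. q - l"])
      (auto simp: ann_commute[of n mu] mult_ac)
qed

text \<open>This is \<open>U\<^sub>\<lambda>(z) U\<^sub>\<mu>(w) = ((1 - w/z) / (1 + w/z)) powr (s / 2) : U\<^sub>\<lambda>(z) U\<^sub>\<mu>(w) :\<close> for \<open>|z| > |w|\<close>.\<close>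

lemma Uop_Uop:
  assumes s: "s = (\<Sum>j=1..n. lam j * mu j)" and K: "k + int (wdeg f) \<le> int K"
  shows "Uop n lam m (Uop n mu k f) =
    (\<Sum>i\<le>K. pscale (exchange_coeff s i) (normal_product n lam mu (m + int i) (k - int i) f))"
proof -
  let ?L = "wdeg f" and ?G = "\<lambda>l p. ann n lam l (ann n mu p f)"
  have ann_U: "ann n lam l (Uop n mu k f) = (\<Sum>i\<le>l. \<Sum>p\<le>?L.
      pscale (exchange_coeff s i) (cre n mu (k + int p - int i) * ?G (l - i) p))" for l
    by (subst sum.swap) (simp add: Uop_eq_sum_wdeg ann_linear ann_cre[OF s])
  have zero: "cre n mu (k + int p - int i) * ?G l p = 0" if "l + i > K" for i l p
  proof (cases "l + p > ?L")
    case False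
    then have "k + int p - int i < 0" using that K by simp
    then show ?thesis by (simp add: cre_neg)
  qed (simp add: ann_ann_eq_0)
  have "ann n lam l (Uop n mu k f) = 0" if "l > K" for l
    unfolding ann_U using that by (intro sum.neutral ballI) (simp add: zero)
  then have "Uop n lam m (Uop n mu k f) =
      (\<Sum>l\<le>K. cre n lam (m + int l) * ann n lam l (Uop n mu k f))"
    by (rule Uop_eq_sum)
  also have "\<dots> = (\<Sum>l\<le>K. \<Sum>i\<le>l. \<Sum>p\<le>?L. pscale (exchange_coeff s i)
      (cre n lam (m + int (i + (l - i))) * cre n mu (k + int p - int i) * ?G (l - i) p))"
    by (simp add: ann_U sum_distrib_left pscale_mult_right mult.assoc)
  also have "\<dots> = (\<Sum>i\<le>K. \<Sum>l\<le>K - i. \<Sum>p\<le>?L. pscale (exchange_coeff s i)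
      (cre n lam (m + int (i + l)) * cre n mu (k + int p - int i) * ?G l p))"
    by (rule sum_triangle_diag)
  also have "\<dots> = (\<Sum>i\<le>K. pscale (exchange_coeff s i) (normal_product n lam mu (m + int i) (k - int i) f))"
  proof (rule sum.cong[OF refl])
    fix i assume "i \<in> {..K}"
    let ?H = "\<lambda>l p. cre n lam (m + int i + int l) * cre n mu (k - int i + int p) * ?G l p"
    have H: "?H l p = 0" if "l + i > K \<or> l + p > ?L" for l p
      using that zero[of l i p] by (auto simp: mult.assoc ann_ann_eq_0 algebra_simps)
    have "(\<Sum>l\<le>K - i. \<Sum>p\<le>?L. ?H l p) = (\<Sum>(l, p)\<in>{..K - i} \<times> {..?L}. ?H l p)"
      by (rule sum.cartesian_product)
    also have "\<dots> = (\<Sum>(l, p)\<in>{(l, p). l + p \<le> ?L}. ?H l p)"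
    proof (rule sum.mono_neutral_cong)
      have "{(l, p). l + p \<le> ?L} \<subseteq> {..?L} \<times> {..?L}" by auto
      then show "finite {(l, p). l + p \<le> ?L}" by (rule finite_subset) simp
    next
      fix x assume "x \<in> {(l, p). l + p \<le> ?L} - {..K - i} \<times> {..?L}"
      then obtain l p where "x = (l, p)" "l + p \<le> ?L" "l > K - i" by force
      then show "(case x of (l, p) \<Rightarrow> ?H l p) = 0" using H[of l p] \<open>i \<in> {..K}\<close> by auto
    qed (use H in \<open>auto simp: not_le\<close>)
    also have "\<dots> = normal_product n lam mu (m + int i) (k - int i) f"
      unfolding normal_product_def by (rule sum.triangle_reindex_eq)
    finally show "(\<Sum>l\<le>K - i. \<Sum>p\<le>?L. pscale (exchange_coeff s i)
      (cre n lam (m + int (i + l)) * cre n mu (k + int p - int i) * ?G l p)) =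
      pscale (exchange_coeff s i) (normal_product n lam mu (m + int i) (k - int i) f)"
      by (simp add: algebra_simps flip: poly.scale_sum_right)
  qed
  finally show ?thesis .
qed

lemma Uop_Uop_int:
  assumes s: "s = (\<Sum>j=1..n. lam j * mu j)"
    and I: "finite I" "{m..m + int (nat (k + int (wdeg f)))} \<subseteq> I"
  shows "Uop n lam m (Uop n mu k f) =
    (\<Sum>a\<in>I. pscale (if m \<le> a then exchange_coeff s (nat (a - m)) else 0)
       (normal_product n lam mu a (m + k - a) f))"
proof -
  define K where "K = nat (k + int (wdeg f))"
  let ?h = "\<lambda>a. pscale (if m \<le> a then exchange_coeff s (nat (a - m)) else 0)
       (normal_product n lam mu a (m + k - a) f)"
  have "Uop n lam m (Uop n mu k f) =
      (\<Sum>i\<le>K. pscale (exchange_coeff s i) (normal_product n lam mu (m + int i) (k - int i) f))"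
    by (rule Uop_Uop[OF s]) (simp add: K_def)
  also have "\<dots> = (\<Sum>a\<in>{m..m + int K}. ?h a)"
    by (rule sum.reindex_bij_witness[of _ "\<lambda>a. nat (a - m)" "\<lambda>i. m + int i"]) auto
  also have "\<dots> = (\<Sum>a\<in>I. ?h a)"
  proof (rule sum.mono_neutral_left[OF I(1)])
    show "{m..m + int K} \<subseteq> I" using I(2) by (simp add: K_def)
    show "\<forall>a\<in>I - {m..m + int K}. ?h a = 0"
    proof
      fix a assume "a \<in> I - {m..m + int K}"
      then have "a < m \<or> m + k - a < - int (wdeg f)"
        by (cases "k + int (wdeg f) \<ge> 0") (auto simp: K_def)
      then show "?h a = 0" by (auto simp: normal_product_eq_0)
    qed
  qed
  finally show ?thesis .
qed

text \<open>\<open>\<psi>\<close> collects the coefficients of the two expansions, in \<open>w/z\<close> and in \<open>z/w\<close>, on a common two-sided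
  scale. Any bound \<open>K\<close> beyond the support of the summands serves.\<close>

lemma Uop_commutator:
  fixes \<epsilon> :: complex
  assumes s: "s = (\<Sum>j=1..n. lam j * mu j)"
    and K: "K \<ge> 2 * (\<bar>m\<bar> + \<bar>k\<bar> + int (wdeg f))"
    and \<psi>: "\<And>d. \<psi> d = (if d \<ge> 0 then exchange_coeff s (nat d) else 0)
                - \<epsilon> * (if d \<le> 0 then exchange_coeff s (nat (- d)) else 0)"
  shows "Uop n lam m (Uop n mu k f) - pscale \<epsilon> (Uop n mu k (Uop n lam m f)) =
    (\<Sum>a\<in>{- K..K}. pscale (\<psi> (a - m)) (normal_product n lam mu a (m + k - a) f))"
proof -
  have "Uop n lam m (Uop n mu k f) = (\<Sum>a\<in>{- K..K}. pscale (if m \<le> a then exchange_coeff s (nat (a - m)) else 0)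
       (normal_product n lam mu a (m + k - a) f))"
    using K by (intro Uop_Uop_int[OF s]) auto
  moreover have "Uop n mu k (Uop n lam m f) =
      (\<Sum>b\<in>{m + k - K..m + k + K}. pscale (if k \<le> b then exchange_coeff s (nat (b - k)) else 0)
       (normal_product n mu lam b (k + m - b) f))"
    using K by (intro Uop_Uop_int) (auto simp: s mult.commute)
  moreover have "\<dots> = (\<Sum>a\<in>{- K..K}. pscale (if a \<le> m then exchange_coeff s (nat (m - a)) else 0)
       (normal_product n lam mu a (m + k - a) f))"
    by (rule sum.reindex_bij_witness[of _ "\<lambda>a. m + k - a" "\<lambda>b. m + k - b"])
      (auto simp: normal_product_swap[of n mu lam] algebra_simps)
  moreover have "pscale (\<psi> (a - m)) g = pscale (if m \<le> a then exchange_coeff s (nat (a - m)) else 0) g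
      - pscale \<epsilon> (pscale (if a \<le> m then exchange_coeff s (nat (m - a)) else 0) g)" for a g
    by (simp add: \<psi> poly.scale_left_diff_distrib)
  ultimately show ?thesis
    by (simp only: poly.scale_sum_right sum_subtractf)
qed


section \<open>Normally ordered products on the diagonals\<close>

text \<open>The coefficient of \<open>z\<^sup>M\<^sup>+\<^sup>x\<^sup>+\<^sup>y\<close> in a product \<open>u(z) v(z)\<close> of power series, with the summation
  index shifted by \<open>x\<close>.\<close>

lemma sum_shifted_conv:
  fixes u v :: "int \<Rightarrow> xpoly"
  assumes u: "\<And>k. k < 0 \<Longrightarrow> u k = 0" and v: "\<And>k. k < 0 \<Longrightarrow> v k = 0"
    and I: "finite I" "{- x..M + y} \<subseteq> I"
  shows "(\<Sum>a\<in>I. u (a + x) * v (M - a + y)) =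
    (if M + x + y \<ge> 0 then \<Sum>i\<le>nat (M + x + y). u (int i) * v (int (nat (M + x + y) - i)) else 0)"
proof -
  have "(\<Sum>a\<in>I. u (a + x) * v (M - a + y)) = (\<Sum>a\<in>{- x..M + y}. u (a + x) * v (M - a + y))"
    by (rule sum.mono_neutral_right[OF I]) (auto simp: u v)
  also have "\<dots> = (if M + x + y \<ge> 0 then \<Sum>i\<le>nat (M + x + y). u (int i) * v (int (nat (M + x + y) - i)) else 0)"
  proof (cases "M + x + y \<ge> 0")
    case True
    have "(\<Sum>a\<in>{- x..M + y}. u (a + x) * v (M - a + y)) =
        (\<Sum>i\<le>nat (M + x + y). u (int i) * v (int (nat (M + x + y) - i)))"
      by (rule sum.reindex_bij_witness[of _ "\<lambda>i. int i - x" "\<lambda>a. nat (a + x)"])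
        (use True in \<open>auto simp: of_nat_diff algebra_simps\<close>)
    then show ?thesis using True by simp
  qed simp
  finally show ?thesis .
qed

lemma cre_add:
  "(\<Sum>i\<le>m. cre n lam (int i) * cre n mu (int (m - i))) = cre n (\<lambda>j. lam j + mu j) (int m)"
  using exp_add[OF commuting_creation commuting_creation creation_commute, of n lam mu m 1]
  by (simp add: exp_creation creation_add[symmetric])

lemma ann_add:
  "(\<Sum>i\<le>m. ann n lam i (ann n mu (m - i) f)) = ann n (\<lambda>j. lam j + mu j) m f"
  using exp_add[OF commuting_annihilation commuting_annihilation annihilation_commute, of n lam mu m f]
  by (simp add: annihilation_add[symmetric])

lemma cre_shifted_add:
  assumes "finite I" "{- x..M + y} \<subseteq> I"
  shows "(\<Sum>a\<in>I. cre n lam (a + x) * cre n mu (M - a + y)) = cre n (\<lambda>j. lam j + mu j) (M + x + y)"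
  by (simp only: sum_shifted_conv[of "cre n lam" "cre n mu", OF cre_neg cre_neg assms] cre_add)
    (simp add: cre_neg)

text \<open>Restriction to \<open>z = w\<close> multiplies the two creation exponentials and the two annihilation
  exponentials separately.\<close>

lemma sum_normal_product:
  assumes "finite I" "{- int (wdeg f)..M + int (wdeg f)} \<subseteq> I"
  shows "(\<Sum>a\<in>I. normal_product n lam mu a (M - a) f) = Uop n (\<lambda>j. lam j + mu j) M f"
proof -
  have "(\<Sum>a\<in>I. normal_product n lam mu a (M - a) f) =
      (\<Sum>q\<le>wdeg f. \<Sum>l\<le>q. (\<Sum>a\<in>I. cre n lam (a + int l) * cre n mu (M - a + int (q - l)))
        * ann n lam l (ann n mu (q - l) f))"
    unfolding normal_product_def sum_distrib_right
    by (subst sum.swap, rule sum.cong[OF refl], rule sum.swap)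
  also have "\<dots> = (\<Sum>q\<le>wdeg f. \<Sum>l\<le>q. cre n (\<lambda>j. lam j + mu j) (M + int q)
        * ann n lam l (ann n mu (q - l) f))"
  proof (intro sum.cong refl)
    fix q l assume "q \<in> {..wdeg f}" "l \<in> {..q}"
    then have "{- int l..M + int (q - l)} \<subseteq> I" using assms(2) by auto
    from cre_shifted_add[OF assms(1) this] \<open>l \<in> {..q}\<close>
    show "(\<Sum>a\<in>I. cre n lam (a + int l) * cre n mu (M - a + int (q - l))) * ann n lam l (ann n mu (q - l) f)
      = cre n (\<lambda>j. lam j + mu j) (M + int q) * ann n lam l (ann n mu (q - l) f)"
      by (simp add: of_nat_diff)
  qed
  also have "\<dots> = Uop n (\<lambda>j. lam j + mu j) M f"
    by (simp add: Uop_eq_sum_wdeg ann_add flip: sum_distrib_left)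
  finally show ?thesis .
qed

text \<open>Replacing \<open>\<lambda>\<close> by \<open>- \<lambda>\<close> amounts to replacing \<open>z\<close> by \<open>- z\<close>, because only odd \<open>r\<close> occur in the
  exponents. This reduces the pole \<open>z = - w\<close> to the diagonal \<open>z = w\<close>.\<close>

lemma normal_product_uminus:
  "normal_product n (\<lambda>j. - lam j) mu a b f = pscale ((-1) powi a) (normal_product n lam mu a b f)"
proof -
  have c: "cre n (\<lambda>j. - lam j) k = pscale ((-1) powi k) (cre n lam k)" for k
    by (simp add: cre_def creation_uminus exp_alternate[OF commuting_creation] power_int_def)
  have d: "ann n (\<lambda>j. - lam j) l g = pscale ((-1) ^ l) (ann n lam l g)" for l g
    by (simp add: annihilation_uminus exp_alternate[OF commuting_annihilation])
  have "(-1) ^ l * (-1) powi (a + int l) = ((-1) powi a :: complex)" for l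
    by (simp add: power_int_add flip: power_mult_distrib)
  then show ?thesis
    by (simp add: normal_product_def c d poly.scale_sum_right pscale_mult_left pscale_mult_right)
qed

lemma Uop_zero: "Uop n (\<lambda>j. 0) m f = (if m = 0 then f else 0)"
proof -
  have "cre n (\<lambda>j. 0) k = (if k = 0 then 1 else 0)" for k
    by (auto simp: cre_def creation_zero exp_zero)
  moreover have "ann n (\<lambda>j. 0) l f = 0" if "l > 0" for l
    using that by (simp add: annihilation_zero exp_zero)
  ultimately show ?thesis
    by (subst Uop_eq_sum[of 0]) (auto simp: annihilation_zero exp_zero)
qed

text \<open>The derivative \<open>z \<partial>/\<partial>z\<close> of \<open>: U\<^sub>-\<^sub>\<mu>(z) U\<^sub>\<mu>(w) :\<close> at \<open>z = w\<close>: the exponentials cancel there, and what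
  remains is the derivative of the exponents, a Heisenberg operator.\<close>

lemma sum_index_normal_product:
  assumes I: "finite I" "{- int (wdeg f)..M + int (wdeg f)} \<subseteq> I"
  shows "(\<Sum>a\<in>I. pscale (of_int a) (normal_product n (\<lambda>j. - mu j) mu a (M - a) f)) =
    - (if odd M then \<Sum>j=1..n. pscale (mu j) (heis j (- M) f) else 0)"
proof -
  define lam where "lam = (\<lambda>j. - mu j)"
  let ?G = "\<lambda>l p. ann n lam l (ann n mu p f)"
  \<comment> \<open>\<open>X\<close> holds the coefficients of the logarithmic derivative of the creation exponential, \<open>Y\<close> those
     of \<open>1\<close>, the product of two inverse creation exponentials.\<close>
  define X where "X k = (if k \<ge> 0 then pscale (of_int k) (creation n lam (nat k) 1) else 0)" for k :: int
  define Y where "Y k = (if k = 0 then 1 else 0 :: xpoly)" for k :: int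
  have lm: "(\<lambda>j. lam j + mu j) = (\<lambda>j. 0)" by (simp add: lam_def)
  have G: "(\<Sum>l\<le>q. ?G l (q - l)) = (if q = 0 then f else 0)" for q
    by (simp add: ann_add lm annihilation_zero exp_zero)
  have EG: "(\<Sum>l\<le>q. pscale (of_nat l) (?G l (q - l))) = pscale (of_nat q) (annihilation n lam q f)" for q
    by (rule euler_exp_inverse[OF commuting_annihilation commuting_annihilation annihilation_commute])
      (simp add: fun_cong[OF fun_cong[OF annihilation_add], symmetric] lm annihilation_zero)
  have EC: "(\<Sum>i\<le>m. pscale (of_nat i) (cre n lam (int i)) * cre n mu (int (m - i)))
      = pscale (of_nat m) (creation n lam m 1)" for m
    using euler_exp_inverse[OF commuting_creation commuting_creation creation_commute, of n lam mu m 1]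
    by (simp add: fun_cong[OF fun_cong[OF creation_add], symmetric] lm creation_zero exp_creation pscale_mult_left)
  have "(\<Sum>a\<in>I. pscale (of_int a) (normal_product n lam mu a (M - a) f)) =
      (\<Sum>q\<le>wdeg f. \<Sum>l\<le>q. (\<Sum>a\<in>I. pscale (of_int a) (cre n lam (a + int l) * cre n mu (M - a + int (q - l)))) * ?G l (q - l))"
    unfolding normal_product_def sum_distrib_right poly.scale_sum_right pscale_mult_left
    by (subst sum.swap, rule sum.cong[OF refl], rule sum.swap)
  also have "\<dots> = (\<Sum>q\<le>wdeg f. \<Sum>l\<le>q. X (M + int q) * ?G l (q - l) - Y (M + int q) * pscale (of_nat l) (?G l (q - l)))"
  proof (intro sum.cong refl)
    fix q l assume ql: "q \<in> {..wdeg f}" "l \<in> {..q}"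
    then have sub: "{- int l..M + int (q - l)} \<subseteq> I" using I(2) by auto
    \<comment> \<open>The index \<open>a = (a + l) - l\<close> splits into the degrees of the creation and the annihilation part.\<close>
    have "(\<Sum>a\<in>I. pscale (of_int a) (cre n lam (a + int l) * cre n mu (M - a + int (q - l)))) =
        (\<Sum>a\<in>I. pscale (of_int (a + int l)) (cre n lam (a + int l)) * cre n mu (M - a + int (q - l)))
        - pscale (of_nat l) (\<Sum>a\<in>I. cre n lam (a + int l) * cre n mu (M - a + int (q - l)))"
      by (simp add: pscale_mult_left poly.scale_left_distrib distrib_right sum.distrib poly.scale_sum_right)
    also have "(\<Sum>a\<in>I. pscale (of_int (a + int l)) (cre n lam (a + int l)) * cre n mu (M - a + int (q - l))) = X (M + int q)"
    proof -
      have "int l + int (q - l) = int q" using ql by simp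
      then have "M + int l + int (q - l) = M + int q" by linarith
      with sum_shifted_conv[of "\<lambda>k. pscale (of_int k) (cre n lam k)" "cre n mu", OF _ cre_neg I(1) sub]
      show ?thesis by (simp only: cre_neg poly.scale_zero_right of_int_of_nat_eq EC X_def)
        (simp add: of_nat_nat)
    qed
    also have "(\<Sum>a\<in>I. cre n lam (a + int l) * cre n mu (M - a + int (q - l))) = Y (M + int q)"
      using ql by (subst cre_shifted_add[OF I(1) sub])
        (auto simp: lm cre_def creation_zero exp_zero Y_def of_nat_diff)
    finally show "(\<Sum>a\<in>I. pscale (of_int a) (cre n lam (a + int l) * cre n mu (M - a + int (q - l)))) * ?G l (q - l)
      = X (M + int q) * ?G l (q - l) - Y (M + int q) * pscale (of_nat l) (?G l (q - l))"
      by (simp add: left_diff_distrib pscale_mult_left pscale_mult_right)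
  qed
  also have "\<dots> = (\<Sum>q\<le>wdeg f. X (M + int q) * (if q = 0 then f else 0))
      - (\<Sum>q\<le>wdeg f. Y (M + int q) * pscale (of_nat q) (annihilation n lam q f))"
    by (simp add: sum_subtractf G EG flip: sum_distrib_left)
  also have "(\<Sum>q\<le>wdeg f. X (M + int q) * (if q = 0 then f else 0)) = X M * f"
    by (simp add: if_distrib[where f = "(*) _"] cong: if_cong)
  also have "(\<Sum>q\<le>wdeg f. Y (M + int q) * pscale (of_nat q) (annihilation n lam q f))
      = (if M \<le> 0 then pscale (of_int (- M)) (annihilation n lam (nat (- M)) f) else 0)"
  proof -
    have "(\<Sum>q\<le>wdeg f. Y (M + int q) * pscale (of_nat q) (annihilation n lam q f)) =
       (\<Sum>q\<le>wdeg f. if q = nat (- M) \<and> M \<le> 0 then pscale (of_int (- M)) (annihilation n lam (nat (- M)) f) else 0)"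
      by (rule sum.cong) (auto simp: Y_def)
    also have "\<dots> = (if M \<le> 0 then pscale (of_int (- M)) (annihilation n lam (nat (- M)) f) else 0)"
      using weight_le_imp_0[OF weight_le_annihilation[OF weight_le_wdeg], of f "nat (- M)" n lam]
      by (auto simp: not_le)
    finally show ?thesis .
  qed
  also have "X M * f - (if M \<le> 0 then pscale (of_int (- M)) (annihilation n lam (nat (- M)) f) else 0)
      = - (if odd M then \<Sum>j=1..n. pscale (mu j) (heis j (- M) f) else 0)"
  proof (cases "M = 0 \<or> even M")
    case True
    then show ?thesis by (auto simp: X_def creation_def annihilation_def even_nat_iff)
  next
    case False
    then consider "M > 0" "odd M" "odd (nat M)" | "M < 0" "odd M" "odd (nat (- M))"
      by (cases "M > 0") (auto simp: even_nat_iff)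
    then show ?thesis
    proof cases
      case 1
      then show ?thesis
        by (simp add: X_def creation_def heis_def lam_def poly.scale_sum_right sum_distrib_right
            pscale_mult_left sum_negf mult.commute[of "mu _"])
    next
      case 2
      then show ?thesis
        by (simp add: X_def annihilation_def heis_def lam_def poly.scale_sum_right sum_negf)
    qed
  qed
  finally show ?thesis by (simp add: lam_def)
qed


section \<open>Commutators of vertex operators on polynomials\<close>

text \<open>The exponents \<open>s / 2 = 0, -1, 1, 2\<close> give the series of \<open>1\<close>, \<open>(1 + t) / (1 - t)\<close>,
  \<open>(1 - t) / (1 + t)\<close> and \<open>((1 - t) / (1 + t))\<^sup>2\<close>.\<close>

lemma exchange_coeff_Suc_Suc_eqI:
  assumes "of_nat (p + 2) * x = of_nat p * exchange_coeff s p - s * exchange_coeff s (Suc p)"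
  shows "exchange_coeff s (Suc (Suc p)) = x"
proof -
  have "(of_nat (p + 2) :: complex) \<noteq> 0" unfolding of_nat_eq_0_iff by simp
  then show ?thesis unfolding exchange_coeff.simps assms[symmetric] by (simp del: of_nat_add)
qed

lemma exchange_coeff_0: "exchange_coeff 0 p = (if p = 0 then 1 else 0)"
  by (induction p rule: induct_nat_012) auto

lemma exchange_coeff_minus_2: "exchange_coeff (- 2) p = (if p = 0 then 1 else 2)"
proof (induction p rule: induct_nat_012)
  case (ge2 p)
  show ?case by (rule exchange_coeff_Suc_Suc_eqI) (auto simp: ge2 algebra_simps)
qed auto

lemma exchange_coeff_2: "exchange_coeff 2 p = (if p = 0 then 1 else 2 * (- 1) ^ p)"
proof (induction p rule: induct_nat_012)
  case (ge2 p)
  show ?case by (rule exchange_coeff_Suc_Suc_eqI) (auto simp: ge2 algebra_simps)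
qed auto

lemma exchange_coeff_4: "exchange_coeff 4 p = (if p = 0 then 1 else 4 * of_nat p * (- 1) ^ p)"
proof (induction p rule: induct_nat_012)
  case (ge2 p)
  show ?case by (rule exchange_coeff_Suc_Suc_eqI) (auto simp: ge2 algebra_simps)
qed auto

lemma Uop_commutator_0:
  assumes "(\<Sum>j=1..n. lam j * mu j) = 0"
  shows "Uop n lam m (Uop n mu k f) - pscale 1 (Uop n mu k (Uop n lam m f)) = 0"
  by (subst Uop_commutator[where \<psi> = "\<lambda>d. 0", OF assms[symmetric] order_refl])
    (auto simp: exchange_coeff_0)

text \<open>Here \<open>\<psi>\<close> is constant, a multiple of the delta distribution at \<open>z = w\<close>: the constant terms 1 of both
  expansions add up to 2, the value of all other coefficients.\<close>

lemma Uop_commutator_minus_2: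
  assumes "(\<Sum>j=1..n. lam j * mu j) = - 2"
  shows "Uop n lam m (Uop n mu k f) - pscale (- 1) (Uop n mu k (Uop n lam m f)) =
    pscale 2 (Uop n (\<lambda>j. lam j + mu j) (m + k) f)"
  by (subst Uop_commutator[where \<psi> = "\<lambda>d. 2", OF assms[symmetric] order_refl])
    (auto simp: exchange_coeff_minus_2 simp flip: poly.scale_sum_right
      intro!: sum_normal_product arg_cong[where f = "pscale 2"])

lemma minus_one_powi_diff: "(- 1 :: complex) powi (a - m) = (- 1) powi m * (- 1) powi a"
  by (simp add: power_int_diff power_int_minus_one_minus divide_inverse flip: power_int_minus)

text \<open>Now \<open>\<psi>\<^sub>d = 2 (-1)\<^sup>d\<close>, and the alternating sign turns \<open>\<lambda>\<close> into \<open>- \<lambda>\<close>.\<close>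

lemma Uop_commutator_2:
  assumes "(\<Sum>j=1..n. lam j * mu j) = 2"
  shows "Uop n lam m (Uop n mu k f) - pscale (- 1) (Uop n mu k (Uop n lam m f)) =
    pscale (2 * (- 1) powi m) (Uop n (\<lambda>j. - lam j + mu j) (m + k) f)"
proof -
  define K where "K = 2 * (\<bar>m\<bar> + \<bar>k\<bar> + int (wdeg f))"
  have "Uop n lam m (Uop n mu k f) - pscale (- 1) (Uop n mu k (Uop n lam m f)) =
      (\<Sum>a\<in>{- K..K}. pscale (2 * (- 1) powi (a - m)) (normal_product n lam mu a (m + k - a) f))"
    by (rule Uop_commutator[OF assms[symmetric]], simp add: K_def)
      (auto simp: exchange_coeff_2 power_int_def)
  also have "\<dots> = pscale (2 * (- 1) powi m)
      (\<Sum>a\<in>{- K..K}. normal_product n (\<lambda>j. - lam j) mu a (m + k - a) f)"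
    by (simp add: poly.scale_sum_right normal_product_uminus minus_one_powi_diff mult.assoc)
  also have "(\<Sum>a\<in>{- K..K}. normal_product n (\<lambda>j. - lam j) mu a (m + k - a) f) =
      Uop n (\<lambda>j. - lam j + mu j) (m + k) f"
    by (rule sum_normal_product) (auto simp: K_def)
  finally show ?thesis .
qed

text \<open>Now \<open>\<psi>\<^sub>d = 4 d (-1)\<^sup>d\<close>, which with \<open>d = a - m\<close> leads to the derivative of the normally ordered
  product and to the product itself, which is the identity on \<open>z = - w\<close>.\<close>

lemma Uop_commutator_4:
  assumes "(\<Sum>j=1..n. lam j * lam j) = 4"
  shows "Uop n lam m (Uop n lam k f) - pscale 1 (Uop n lam k (Uop n lam m f)) =
    pscale (- 4 * (- 1) powi m)
      ((if m + k = 0 then pscale (of_int m) f else 0)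
       + (if odd (m + k) then \<Sum>j=1..n. pscale (lam j) (heis j (- (m + k)) f) else 0))"
proof -
  define K where "K = 2 * (\<bar>m\<bar> + \<bar>k\<bar> + int (wdeg f))"
  let ?N = "\<lambda>a. normal_product n (\<lambda>j. - lam j) lam a (m + k - a) f"
  have K: "{- int (wdeg f)..m + k + int (wdeg f)} \<subseteq> {- K..K}" by (auto simp: K_def)
  have "Uop n lam m (Uop n lam k f) - pscale 1 (Uop n lam k (Uop n lam m f)) =
      (\<Sum>a\<in>{- K..K}. pscale (4 * of_int (a - m) * (- 1) powi (a - m)) (normal_product n lam lam a (m + k - a) f))"
    by (rule Uop_commutator[OF assms[symmetric]], simp add: K_def)
      (auto simp: exchange_coeff_4 power_int_def of_nat_nat)
  also have "\<dots> = pscale (4 * (- 1) powi m)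
      ((\<Sum>a\<in>{- K..K}. pscale (of_int a) (?N a)) - pscale (of_int m) (\<Sum>a\<in>{- K..K}. ?N a))"
    by (simp add: poly.scale_sum_right normal_product_uminus minus_one_powi_diff mult_ac
        left_diff_distrib right_diff_distrib poly.scale_left_diff_distrib poly.scale_right_diff_distrib
        sum_subtractf)
  also have "(\<Sum>a\<in>{- K..K}. ?N a) = (if m + k = 0 then f else 0)"
    by (subst sum_normal_product[OF _ K]) (simp_all add: Uop_zero)
  also have "(\<Sum>a\<in>{- K..K}. pscale (of_int a) (?N a)) =
      - (if odd (m + k) then \<Sum>j=1..n. pscale (lam j) (heis j (- (m + k)) f) else 0)"
    by (rule sum_index_normal_product[OF _ K]) simp
  finally show ?thesis
    by (simp add: poly.scale_right_distrib poly.scale_right_diff_distrib)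
qed


section \<open>Expansions of homogeneous rational functions\<close>

text \<open>A function homogeneous of degree \<open>q\<close> is \<open>w\<^sup>q h(w/z)\<close>, and its expansion for \<open>|z| > |w|\<close> is the Taylor
  expansion of \<open>h\<close>; for \<open>|w| > |z|\<close> the same holds with \<open>z/w\<close>.\<close>

lemma iota_zw_homogeneous:
  assumes h: "\<And>t. norm t < 1 \<Longrightarrow> ((\<lambda>i. s i * t ^ i) has_sum h t) (UNIV :: nat set)"
    and R: "\<And>z w. 0 < norm w \<Longrightarrow> norm w < norm z \<Longrightarrow> R z w = w powi q * h (w / z)"
  shows "iota_zw R = (\<lambda>m k. if k = q - m \<and> m \<le> 0 then s (nat (- m)) else 0)"
proof (rule iota_zw_eqI)
  fix z w :: complex assume zw: "0 < norm w" "norm w < norm z"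
  let ?c = "\<lambda>m k. if k = q - m \<and> m \<le> 0 then s (nat (- m)) else 0"
  let ?g = "\<lambda>i::nat. (- int i, q + int i)"
  have "z \<noteq> 0" "w \<noteq> 0" using zw by auto
  have "norm (w / z) < 1" using zw \<open>z \<noteq> 0\<close> by (simp add: norm_divide divide_simps)
  from has_sum_cmult_right[OF h[OF this], of "w powi q"]
  have "((\<lambda>i. w powi q * (s i * (w / z) ^ i)) has_sum R z w) UNIV" using R[OF zw] by simp
  also have "(\<lambda>i. w powi q * (s i * (w / z) ^ i)) = (\<lambda>(m, k). ?c m k * z powi m * w powi k) \<circ> ?g"
    using \<open>z \<noteq> 0\<close> \<open>w \<noteq> 0\<close>
    by (auto simp: fun_eq_iff power_int_add power_int_minus power_divide field_simps)
  also have "((\<lambda>(m, k). ?c m k * z powi m * w powi k) \<circ> ?g has_sum R z w) UNIV \<longleftrightarrow>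
      ((\<lambda>(m, k). ?c m k * z powi m * w powi k) has_sum R z w) (range ?g)"
    by (rule has_sum_reindex[symmetric]) (auto simp: inj_on_def)
  also have "\<dots> \<longleftrightarrow> ((\<lambda>(m, k). ?c m k * z powi m * w powi k) has_sum R z w) UNIV"
  proof (rule has_sum_cong_neutral)
    fix x :: "int \<times> int" assume x: "x \<in> UNIV - range ?g"
    have "\<not> (snd x = q - fst x \<and> fst x \<le> 0)"
    proof
      assume "snd x = q - fst x \<and> fst x \<le> 0"
      then have "x = ?g (nat (- fst x))" by (cases x) auto
      with x show False by blast
    qed
    then show "(case x of (m, k) \<Rightarrow> ?c m k * z powi m * w powi k) = 0"
      by (cases x) auto
  qed auto
  finally show "((\<lambda>(m, k). ?c m k * z powi m * w powi k) has_sum R z w) UNIV" .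
qed

lemma iota_wz_homogeneous:
  assumes h: "\<And>t. norm t < 1 \<Longrightarrow> ((\<lambda>i. s i * t ^ i) has_sum h t) (UNIV :: nat set)"
    and R: "\<And>z w. 0 < norm z \<Longrightarrow> norm z < norm w \<Longrightarrow> R z w = w powi q * h (z / w)"
  shows "iota_wz R = (\<lambda>m k. if k = q - m \<and> m \<ge> 0 then s (nat m) else 0)"
proof (rule iota_wz_eqI)
  fix z w :: complex assume zw: "0 < norm z" "norm z < norm w"
  let ?c = "\<lambda>m k. if k = q - m \<and> m \<ge> 0 then s (nat m) else 0"
  let ?g = "\<lambda>i::nat. (int i, q - int i)"
  have "z \<noteq> 0" "w \<noteq> 0" using zw by auto
  have "norm (z / w) < 1" using zw \<open>w \<noteq> 0\<close> by (simp add: norm_divide divide_simps)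
  from has_sum_cmult_right[OF h[OF this], of "w powi q"]
  have "((\<lambda>i. w powi q * (s i * (z / w) ^ i)) has_sum R z w) UNIV" using R[OF zw] by simp
  also have "(\<lambda>i. w powi q * (s i * (z / w) ^ i)) = (\<lambda>(m, k). ?c m k * z powi m * w powi k) \<circ> ?g"
    using \<open>z \<noteq> 0\<close> \<open>w \<noteq> 0\<close>
    by (auto simp: fun_eq_iff power_int_diff power_divide field_simps)
  also have "((\<lambda>(m, k). ?c m k * z powi m * w powi k) \<circ> ?g has_sum R z w) UNIV \<longleftrightarrow>
      ((\<lambda>(m, k). ?c m k * z powi m * w powi k) has_sum R z w) (range ?g)"
    by (rule has_sum_reindex[symmetric]) (auto simp: inj_on_def)
  also have "\<dots> \<longleftrightarrow> ((\<lambda>(m, k). ?c m k * z powi m * w powi k) has_sum R z w) UNIV"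
  proof (rule has_sum_cong_neutral)
    fix x :: "int \<times> int" assume x: "x \<in> UNIV - range ?g"
    have "\<not> (snd x = q - fst x \<and> fst x \<ge> 0)"
    proof
      assume "snd x = q - fst x \<and> fst x \<ge> 0"
      then have "x = ?g (nat (fst x))" by (cases x) auto
      with x show False by blast
    qed
    then show "(case x of (m, k) \<Rightarrow> ?c m k * z powi m * w powi k) = 0"
      by (cases x) auto
  qed auto
  finally show "((\<lambda>(m, k). ?c m k * z powi m * w powi k) has_sum R z w) UNIV" .
qed

lemma geometric_has_sum:
  fixes t :: complex
  assumes "norm t < 1"
  shows "((\<lambda>i. t ^ i) has_sum 1 / (1 - t)) (UNIV :: nat set)"
  by (rule norm_summable_imp_has_sum)
    (use assms geometric_sums[of t] in \<open>auto simp: norm_power summable_geometric\<close>)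

lemma geometric_deriv_has_sum:
  fixes t :: complex
  assumes "norm t < 1"
  shows "((\<lambda>i. of_nat (Suc i) * t ^ i) has_sum 1 / (1 - t)\<^sup>2) (UNIV :: nat set)"
proof (rule norm_summable_imp_has_sum)
  have "summable (\<lambda>i. of_nat (Suc i) * norm t ^ i)"
    using geometric_deriv_sums[of "norm t"] assms by (auto simp: sums_iff)
  then show "summable (\<lambda>i. norm (of_nat (Suc i) * t ^ i))"
    by (simp add: norm_mult norm_power del: of_nat_Suc)
qed (rule geometric_deriv_sums[OF assms])

lemma one_has_sum:
  fixes t :: complex
  shows "((\<lambda>i. (if i = 0 then 1 else 0) * t ^ i) has_sum 1) (UNIV :: nat set)"
proof -
  have "((\<lambda>i. (if i = 0 then 1 else 0) * t ^ i) has_sum 1) {0}"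
    using has_sum_finite[of "{0::nat}" "\<lambda>i. (if i = 0 then 1 else 0) * t ^ i"] by simp
  then show ?thesis by (rule has_sum_cong_neutral[THEN iffD1, rotated -1]) auto
qed

lemma iota_diff_z_minus_w: "iota_diff (\<lambda>z w. w / (z - w)) m k = (if k = - m then 1 else 0)"
proof -
  have "iota_zw (\<lambda>z w. w / (z - w)) =
      (\<lambda>m k. if k = 0 - m \<and> m \<le> 0 then 1 - (if nat (- m) = 0 then 1 else 0) else 0)"
  proof (rule iota_zw_homogeneous[where h = "\<lambda>t. 1 / (1 - t) + (- 1)"])
    fix t :: complex assume "norm t < 1"
    from has_sum_add[OF geometric_has_sum[OF this] has_sum_uminusI[OF one_has_sum[of t]]]
    show "((\<lambda>i. (1 - (if i = 0 then 1 else 0)) * t ^ i) has_sum 1 / (1 - t) + - 1) UNIV"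
      by (simp add: left_diff_distrib)
  next
    fix z w :: complex assume "0 < norm w" "norm w < norm z"
    then have "z \<noteq> 0" "z - w \<noteq> 0" by auto
    then show "w / (z - w) = w powi 0 * (1 / (1 - w / z) + - 1)"
      by (simp add: divide_simps)
  qed
  moreover have "iota_wz (\<lambda>z w. w / (z - w)) = (\<lambda>m k. if k = 0 - m \<and> m \<ge> 0 then - 1 else 0)"
  proof (rule iota_wz_homogeneous[where h = "\<lambda>t. - (1 / (1 - t))"])
    fix t :: complex assume "norm t < 1"
    from has_sum_uminusI[OF geometric_has_sum[OF this]]
    show "((\<lambda>i. - 1 * t ^ i) has_sum - (1 / (1 - t))) UNIV" by simp
  next
    fix z w :: complex assume "0 < norm z" "norm z < norm w"
    then have "w \<noteq> 0" "z - w \<noteq> 0" "w - z \<noteq> 0" by auto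
    then show "w / (z - w) = w powi 0 * - (1 / (1 - z / w))"
      by (simp add: divide_simps) (simp add: algebra_simps)
  qed
  ultimately show ?thesis by (auto simp: iota_diff_def)
qed

lemma iota_diff_z_plus_w:
  "iota_diff (\<lambda>z w. c * w ^ Suc q / (z + w)) m k = (if k = int q - m then - c * (- 1) powi m else 0)"
proof -
  have nz: "z + w \<noteq> 0" if "norm z \<noteq> norm w" for z w :: complex
    using that by (metis add_eq_0_iff norm_minus_cancel)
  have "iota_zw (\<lambda>z w. c * w ^ Suc q / (z + w)) = (\<lambda>m k. if k = int q - m \<and> m \<le> 0
      then c * ((if nat (- m) = 0 then 1 else 0) - (- 1) ^ nat (- m)) else 0)"
  proof (rule iota_zw_homogeneous[where h = "\<lambda>t. c * (1 + - (1 / (1 - - t)))"])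
    fix t :: complex assume "norm t < 1"
    then have "norm (- t) < 1" by simp
    from has_sum_cmult_right[OF has_sum_add[OF one_has_sum[of t] has_sum_uminusI[OF geometric_has_sum[OF this]]], of c]
    show "((\<lambda>i. c * ((if i = 0 then 1 else 0) - (- 1) ^ i) * t ^ i) has_sum c * (1 + - (1 / (1 - - t)))) UNIV"
      by (simp add: algebra_simps power_minus[of t])
  next
    fix z w :: complex assume "0 < norm w" "norm w < norm z"
    then show "c * w ^ Suc q / (z + w) = w powi int q * (c * (1 + - (1 / (1 - - (w / z)))))"
      using nz[of z w] by (auto simp: divide_simps add_eq_0_iff)
  qed
  moreover have "iota_wz (\<lambda>z w. c * w ^ Suc q / (z + w)) = (\<lambda>m k. if k = int q - m \<and> m \<ge> 0
      then c * (- 1) ^ nat m else 0)"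
  proof (rule iota_wz_homogeneous[where h = "\<lambda>t. c * (1 / (1 - - t))"])
    fix t :: complex assume "norm t < 1"
    then have "norm (- t) < 1" by simp
    from has_sum_cmult_right[OF geometric_has_sum[OF this], of c]
    show "((\<lambda>i. c * (- 1) ^ i * t ^ i) has_sum c * (1 / (1 - - t))) UNIV"
      by (simp add: algebra_simps power_minus[of t])
  next
    fix z w :: complex assume "0 < norm z" "norm z < norm w"
    then show "c * w ^ Suc q / (z + w) = w powi int q * (c * (1 / (1 - - (z / w))))"
      using nz[of z w] by (auto simp: divide_simps add_eq_0_iff)
  qed
  ultimately show ?thesis by (auto simp: iota_diff_def power_int_def)
qed

lemma iota_diff_double_pole:
  "iota_diff (\<lambda>z w. w / (z + w) - w\<^sup>2 / (z + w)\<^sup>2) m k = (if k = - m then of_int m * (- 1) powi m else 0)"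
proof -
  let ?h = "\<lambda>t::complex. 1 / (1 - - t) + - (1 / (1 - - t)\<^sup>2)"
  have nz: "z + w \<noteq> 0" if "norm z \<noteq> norm w" for z w :: complex
    using that by (metis add_eq_0_iff norm_minus_cancel)
  have h: "((\<lambda>i. - of_nat i * (- 1) ^ i * t ^ i) has_sum ?h t) UNIV" if "norm t < 1" for t
  proof -
    have "norm (- t) < 1" using that by simp
    from has_sum_add[OF geometric_has_sum[OF this] has_sum_uminusI[OF geometric_deriv_has_sum[OF this]]]
    show ?thesis by (simp add: algebra_simps power_minus[of t])
  qed
  \<comment> \<open>The function is \<open>z w / (z + w)\<^sup>2\<close>, which is symmetric in \<open>z\<close> and \<open>w\<close>.\<close>
  have sym: "1 / (1 - - (w / z)) + - (1 / (1 - - (w / z))\<^sup>2) = z * w / (z + w)\<^sup>2"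
    "w / (z + w) - w\<^sup>2 / (z + w)\<^sup>2 = z * w / (z + w)\<^sup>2" if "z + w \<noteq> 0" "z \<noteq> 0" for z w :: complex
  proof -
    have "1 - - (w / z) = (z + w) / z" using that by (simp add: field_simps)
    then show "1 / (1 - - (w / z)) + - (1 / (1 - - (w / z))\<^sup>2) = z * w / (z + w)\<^sup>2"
      using that by (simp add: power_divide divide_simps) (simp add: power2_eq_square algebra_simps)
    show "w / (z + w) - w\<^sup>2 / (z + w)\<^sup>2 = z * w / (z + w)\<^sup>2"
      using that by (simp add: divide_simps) (simp add: power2_eq_square algebra_simps)
  qed
  have "iota_zw (\<lambda>z w. w / (z + w) - w\<^sup>2 / (z + w)\<^sup>2) = (\<lambda>m k. if k = 0 - m \<and> m \<le> 0
      then - of_nat (nat (- m)) * (- 1) ^ nat (- m) else 0)"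
  proof (rule iota_zw_homogeneous[OF h])
    fix z w :: complex assume "0 < norm w" "norm w < norm z"
    then show "w / (z + w) - w\<^sup>2 / (z + w)\<^sup>2 = w powi 0 * ?h (w / z)"
      using sym[of z w] nz[of z w] by (cases "z = 0") auto
  qed
  moreover have "iota_wz (\<lambda>z w. w / (z + w) - w\<^sup>2 / (z + w)\<^sup>2) = (\<lambda>m k. if k = 0 - m \<and> m \<ge> 0
      then - of_nat (nat m) * (- 1) ^ nat m else 0)"
  proof (rule iota_wz_homogeneous[OF h])
    fix z w :: complex assume "0 < norm z" "norm z < norm w"
    then show "w / (z + w) - w\<^sup>2 / (z + w)\<^sup>2 = w powi 0 * ?h (z / w)"
      using sym(1)[of w z] sym(2)[of z w] nz[of z w] by (cases "w = 0") (auto simp: add.commute mult.commute)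
  qed
  ultimately show ?thesis by (auto simp: iota_diff_def power_int_def of_nat_nat)
qed


section \<open>The form and the lattice\<close>

lemma cplx_form_scale: "cplx_form u (cplx_scale c v) = c * cplx_form u v"
  by (simp add: cplx_form_def cplx_scale_def complex_eq_iff inner_diff_right inner_add_right algebra_simps)

lemma cplx_form_add_right: "cplx_form u (v + v') = cplx_form u v + cplx_form u v'"
  by (simp add: cplx_form_def complex_eq_iff inner_add_right)

lemma cplx_form_add_left: "cplx_form (u + u') v = cplx_form u v + cplx_form u' v"
  by (simp add: cplx_form_def complex_eq_iff inner_add_left)

lemma cplx_form_uminus_left: "cplx_form (- u) v = - cplx_form u v"
  by (simp add: cplx_form_def complex_eq_iff)

lemma cplx_embed_add: "cplx_embed (x + y) = cplx_embed x + cplx_embed y"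
  by (simp add: cplx_embed_def)

lemma cplx_embed_uminus: "cplx_embed (- x) = - cplx_embed x"
  by (simp add: cplx_embed_def)

lemma cplx_form_embed: "cplx_form (cplx_embed x) (cplx_embed y) = of_real (x \<bullet> y)"
  by (simp add: cplx_form_def cplx_embed_def complex_eq_iff)

text \<open>Both sides are linear in \<open>v\<close>, and they agree on the basis vectors.\<close>

lemma orthonormal_expansion:
  assumes "orthonormal_cplx_basis n S"
  shows "(\<Sum>j=1..n. cplx_form u (S j) * cplx_form v (S j)) = cplx_form u v"
proof -
  let ?P = "\<lambda>v. (\<Sum>j=1..n. cplx_form u (S j) * cplx_form (S j) v) = cplx_form u v"
  have sym: "cplx_form x y = cplx_form y x" for x y :: "'a \<times> 'a"
    by (simp add: cplx_form_def complex_eq_iff inner_commute add.commute)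
  have zero: "cplx_form x 0 = 0" for x :: "'a \<times> 'a"
    by (simp add: cplx_form_def complex_eq_iff)
  have S: "cplx_form (S j) (S i) = (if i = j then 1 else 0)" if "i \<in> {1..n}" "j \<in> {1..n}" for i j
    using assms that unfolding orthonormal_cplx_basis_def by simp
  have "v \<in> cplx.span (S ` {1..n})"
    using assms unfolding orthonormal_cplx_basis_def by simp
  then have "?P v"
  proof (rule cplx.span_induct)
    show "cplx.subspace (Collect ?P)"
      by (rule cplx.subspaceI)
        (simp_all add: zero cplx_form_add_right cplx_form_scale distrib_left sum.distrib mult_ac
          flip: sum_distrib_left)
    fix x assume "x \<in> S ` {1..n}"
    then obtain i where i: "i \<in> {1..n}" "x = S i" by auto
    have "(\<Sum>j=1..n. cplx_form u (S j) * cplx_form (S j) (S i)) = (\<Sum>j=1..n. if i = j then cplx_form u (S j) else 0)"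
      by (rule sum.cong) (use S i in auto)
    then show "?P x" using i by simp
  qed
  then show ?thesis by (simp only: sym[of v])
qed

text \<open>The vector \<open>\<lambda>\<close> for which \<open>\<Gamma>\<^sub>\<alpha>\<close> is built from \<open>U\<^sub>\<lambda>\<close>.\<close>

definition root_coeffs :: "(nat \<Rightarrow> 'h \<times> 'h) \<Rightarrow> 'h::real_inner \<Rightarrow> nat \<Rightarrow> complex" where
  "root_coeffs S \<alpha> = (\<lambda>j. of_real (sqrt 2) * cplx_form (cplx_embed \<alpha>) (S j))"

lemma root_coeffs_add: "root_coeffs S (\<alpha> + \<beta>) = (\<lambda>j. root_coeffs S \<alpha> j + root_coeffs S \<beta> j)"
  by (simp add: root_coeffs_def cplx_embed_add cplx_form_add_left distrib_left)

lemma root_coeffs_uminus: "root_coeffs S (- \<alpha>) = (\<lambda>j. - root_coeffs S \<alpha> j)"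
  by (simp add: root_coeffs_def cplx_embed_uminus cplx_form_uminus_left)

lemma sum_root_coeffs:
  assumes "orthonormal_cplx_basis n S"
  shows "(\<Sum>j=1..n. root_coeffs S \<alpha> j * root_coeffs S \<beta> j) = of_real (2 * (\<alpha> \<bullet> \<beta>))"
proof -
  have sq: "complex_of_real (sqrt 2) * complex_of_real (sqrt 2) = 2"
    by (simp flip: of_real_mult)
  have "root_coeffs S \<alpha> j * root_coeffs S \<beta> j =
      (complex_of_real (sqrt 2) * complex_of_real (sqrt 2))
        * (cplx_form (cplx_embed \<alpha>) (S j) * cplx_form (cplx_embed \<beta>) (S j))" for j
    by (simp only: root_coeffs_def mult_ac)
  then have "root_coeffs S \<alpha> j * root_coeffs S \<beta> j =
      2 * (cplx_form (cplx_embed \<alpha>) (S j) * cplx_form (cplx_embed \<beta>) (S j))" for j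
    by (simp only: sq)
  then show ?thesis
    using orthonormal_expansion[OF assms, of "cplx_embed \<alpha>" "cplx_embed \<beta>"]
    by (simp add: cplx_form_embed flip: sum_distrib_left)
qed

lemma coset2_add_double:
  assumes "even_integral_lattice n Q" "\<delta> \<in> Q"
  shows "coset2 Q (x + (\<delta> + \<delta>)) = coset2 Q x"
proof -
  have "(\<lambda>\<delta>'. \<delta> + \<delta> + 2 *\<^sub>R \<delta>') ` Q = (\<lambda>\<delta>'. 2 *\<^sub>R \<delta>') ` Q"
  proof (intro equalityI subsetI)
    fix y assume "y \<in> (\<lambda>\<delta>'. \<delta> + \<delta> + 2 *\<^sub>R \<delta>') ` Q"
    then obtain \<delta>' where "\<delta>' \<in> Q" "y = 2 *\<^sub>R (\<delta> + \<delta>')" by (auto simp: scaleR_add_right scaleR_2)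
    then show "y \<in> (\<lambda>\<delta>'. 2 *\<^sub>R \<delta>') ` Q"
      using even_integral_lattice_add_diff(1)[OF assms] by blast
  next
    fix y assume "y \<in> (\<lambda>\<delta>'. 2 *\<^sub>R \<delta>') ` Q"
    then obtain \<delta>' where d: "\<delta>' \<in> Q" "y = \<delta> + \<delta> + 2 *\<^sub>R (\<delta>' - \<delta>)"
      by (auto simp: scaleR_diff_right scaleR_2)
    then show "y \<in> (\<lambda>\<delta>'. \<delta> + \<delta> + 2 *\<^sub>R \<delta>') ` Q"
      using even_integral_lattice_add_diff(2)[OF assms(1) d(1) assms(2)] by blast
  qed
  moreover have "coset2 Q (x + (\<delta> + \<delta>)) = (\<lambda>y. x + y) ` (\<lambda>\<delta>'. \<delta> + \<delta> + 2 *\<^sub>R \<delta>') ` Q"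
    by (auto simp: coset2_def elt_set_plus_def image_iff add.assoc)
  moreover have "coset2 Q x = (\<lambda>y. x + y) ` (\<lambda>\<delta>'. 2 *\<^sub>R \<delta>') ` Q"
    by (auto simp: coset2_def elt_set_plus_def image_iff)
  ultimately show ?thesis by simp
qed


section \<open>Operators on V\<close>

lemma lin_Uop: "lin (Uop n lam m)"
proof (rule linI)
  fix f g
  define L where "L = max (wdeg f) (wdeg g)"
  have f: "ann n lam l f = 0" and g: "ann n lam l g = 0" if "l > L" for l
    using that by (auto simp: L_def intro!: ann_eq_0[OF weight_le_wdeg])
  then have fg: "ann n lam l (f + g) = 0" if "l > L" for l
    using that by (simp add: ann_linear)
  show "Uop n lam m (f + g) = Uop n lam m f + Uop n lam m g"
    by (simp add: Uop_eq_sum[OF f] Uop_eq_sum[OF g] Uop_eq_sum[OF fg] ann_linear distrib_left sum.distrib)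
next
  fix c f
  have f: "ann n lam l f = 0" if "l > wdeg f" for l
    using that by (auto intro!: ann_eq_0[OF weight_le_wdeg])
  then have cf: "ann n lam l (pscale c f) = 0" if "l > wdeg f" for l
    using that by (simp add: ann_linear)
  show "Uop n lam m (pscale c f) = pscale c (Uop n lam m f)"
    by (simp add: Uop_eq_sum[OF f] Uop_eq_sum[OF cf] ann_linear pscale_mult_right poly.scale_sum_right)
qed

lemma lin_heis: "lin (heis j r)"
  by (cases "r > 0")
    (auto simp only: heis_def[abs_def] if_True if_False intro!: lin_pdiff lin_pscale lin_mult)

lemma lookup_vscale: "Poly_Mapping.lookup (vscale c v) C = pscale c (Poly_Mapping.lookup v C)"
  by (simp add: vscale_def Poly_Mapping.map.rep_eq when_def)

lemma vscale_single: "vscale c (Poly_Mapping.single C f) = Poly_Mapping.single C (pscale c f)"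
  by (rule poly_mapping_eqI) (simp add: lookup_vscale lookup_single when_def)

lemma vscale_add: "vscale c (u + v) = vscale c u + vscale c v"
  by (rule poly_mapping_eqI) (simp add: lookup_vscale lookup_add poly.scale_right_distrib)

lemma vscale_0_left: "vscale 0 v = 0"
  by (rule poly_mapping_eqI) (simp add: lookup_vscale)

lemma lookup_afield:
  "Poly_Mapping.lookup (afield j k v) C =
     (if odd (- k - 1) then heis j (- k - 1) (Poly_Mapping.lookup v C) else 0)"
  by (simp add: afield_def Poly_Mapping.map.rep_eq when_def module_hom.zero[OF lin_heis])

lemma afield_single:
  "afield j k (Poly_Mapping.single C f) =
     Poly_Mapping.single C (if odd (- k - 1) then heis j (- k - 1) f else 0)"
  by (rule poly_mapping_eqI)
    (auto simp: lookup_afield lookup_single when_def module_hom.zero[OF lin_heis])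

lemma afield_add: "afield j k (u + v) = afield j k u + afield j k v"
  by (rule poly_mapping_eqI) (simp add: lookup_afield lookup_add module_hom.add[OF lin_heis])

text \<open>Additivity in \<open>v\<close> reduces identities of operators on \<open>V\<close> to the vectors \<open>e\<^sup>\<gamma> \<otimes> f\<close>, on which
  the value of \<open>\<nu>\<close> does not depend on the representative.\<close>

lemma Gam_add: "Gam n \<nu> S \<alpha> m (u + v) = Gam n \<nu> S \<alpha> m u + Gam n \<nu> S \<alpha> m v"
  unfolding Gam_def
  by (rule setsum_keys_plus_distrib)
    (simp_all add: Uop_0 module_hom.add[OF lin_Uop] poly.scale_right_distrib single_add)

text \<open>A scalar distribution that is homogeneous in \<open>(z, w)\<close> has a single power of \<open>w\<close> for each power of
  \<open>z\<close>.\<close>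

lemma dist_mult_diagonal:
  assumes "\<And>l. l \<noteq> l0 \<Longrightarrow> c m l = 0"
  shows "dist_mult c A m k v = vscale (c m l0) (A (k - l0) v)"
proof -
  have "dist_mult c A m k v = (\<Sum>l\<in>{l0}. vscale (c m l) (A (k - l) v))"
    unfolding dist_mult_def
  proof (rule Sum_any.expand_superset)
    show "{l. vscale (c m l) (A (k - l) v) \<noteq> 0} \<subseteq> {l0}"
      using assms by (force simp: vscale_0_left)
  qed simp
  then show ?thesis by simp
qed

lemma additive_eq_on_Vcarrier:
  fixes F G :: "'h::real_vector Vspace \<Rightarrow> 'h Vspace"
  assumes F: "\<And>u v. F (u + v) = F u + F v" and G: "\<And>u v. G (u + v) = G u + G v"
    and "\<And>\<gamma> f. \<gamma> \<in> Q \<Longrightarrow> F (Poly_Mapping.single (coset2 Q \<gamma>) f) = G (Poly_Mapping.single (coset2 Q \<gamma>) f)"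
    and v: "v \<in> Vcarrier n Q"
  shows "F v = G v"
proof -
  interpret F: Modules.additive F by unfold_locales (rule F)
  interpret G: Modules.additive G by unfold_locales (rule G)
  have "v = (\<Sum>C\<in>Poly_Mapping.keys v. Poly_Mapping.single C (Poly_Mapping.lookup v C))"
    by (rule poly_mapping_eqI) (auto simp: lookup_sum lookup_single when_def in_keys_iff)
  moreover have "F (\<Sum>C\<in>Poly_Mapping.keys v. Poly_Mapping.single C (Poly_Mapping.lookup v C))
      = G (\<Sum>C\<in>Poly_Mapping.keys v. Poly_Mapping.single C (Poly_Mapping.lookup v C))"
    unfolding F.sum G.sum
  proof (rule sum.cong[OF refl])
    fix C assume "C \<in> Poly_Mapping.keys v"
    then obtain \<gamma> where "\<gamma> \<in> Q" "C = coset2 Q \<gamma>" using v unfolding Vcarrier_def by auto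
    then show "F (Poly_Mapping.single C (Poly_Mapping.lookup v C)) = G (Poly_Mapping.single C (Poly_Mapping.lookup v C))"
      using assms(3) by simp
  qed
  ultimately show ?thesis by simp
qed

text \<open>Bimultiplicativity collects the signs of both orders into the same product
  \<open>\<nu>(\<alpha>, \<beta>) \<nu>(\<alpha> + \<beta>, \<gamma>)\<close>, up to the factor \<open>(-1)\<^sup>(\<^sup>\<alpha>\<^sup>|\<^sup>\<beta>\<^sup>)\<close> from exchanging \<open>\<alpha>\<close> and \<open>\<beta>\<close>.\<close>

lemma Gam_commutator_single:
  assumes Q: "even_integral_lattice n Q" and \<nu>: "asymmetry_function Q \<nu>"
    and \<alpha>: "\<alpha> \<in> Q" and \<beta>: "\<beta> \<in> Q" and \<gamma>: "\<gamma> \<in> Q"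
  shows "dist_commutator (Gam n \<nu> S \<alpha>) (Gam n \<nu> S \<beta>) m k (Poly_Mapping.single (coset2 Q \<gamma>) f) =
    Poly_Mapping.single (coset2 Q (\<alpha> + \<beta> + \<gamma>)) (pscale (1/4 * \<nu> \<alpha> \<beta> * \<nu> (\<alpha> + \<beta>) \<gamma>)
      (Uop n (root_coeffs S \<alpha>) m (Uop n (root_coeffs S \<beta>) k f)
       - pscale ((-1) powi \<lfloor>\<alpha> \<bullet> \<beta>\<rfloor>)
           (Uop n (root_coeffs S \<beta>) k (Uop n (root_coeffs S \<alpha>) m f))))"
proof -
  have bil: "\<nu> (x + y) \<gamma> = \<nu> x \<gamma> * \<nu> y \<gamma>" "\<nu> x (y + \<gamma>) = \<nu> x y * \<nu> x \<gamma>" if "x \<in> Q" "y \<in> Q" for x y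
    using \<nu> that \<gamma> unfolding asymmetry_function_def by blast+
  have sym: "\<nu> \<beta> \<alpha> = (-1) powi \<lfloor>\<beta> \<bullet> \<alpha>\<rfloor> * \<nu> \<alpha> \<beta>"
    using \<nu> \<alpha> \<beta> unfolding asymmetry_function_def by blast
  have GG: "Gam n \<nu> S x p (Gam n \<nu> S y q (Poly_Mapping.single (coset2 Q \<gamma>) f)) =
      Poly_Mapping.single (coset2 Q (x + y + \<gamma>)) (pscale (1/4 * \<nu> x y * (\<nu> x \<gamma> * \<nu> y \<gamma>))
        (Uop n (root_coeffs S x) p (Uop n (root_coeffs S y) q f)))" if "x \<in> Q" "y \<in> Q" for x y p q
  proof -
    have "Gam n \<nu> S x p (Gam n \<nu> S y q (Poly_Mapping.single (coset2 Q \<gamma>) f)) =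
        Poly_Mapping.single (coset2 Q (x + (y + \<gamma>))) (pscale (1/2 * \<nu> x (y + \<gamma>))
          (Uop n (root_coeffs S x) p (pscale (1/2 * \<nu> y \<gamma>) (Uop n (root_coeffs S y) q f))))"
      unfolding root_coeffs_def Gam_single[OF Q \<nu> that(2) \<gamma>]
      by (rule Gam_single[OF Q \<nu> that(1) even_integral_lattice_add_diff(1)[OF Q that(2) \<gamma>]])
    also have "\<dots> = Poly_Mapping.single (coset2 Q (x + y + \<gamma>))
        (pscale ((1/2 * \<nu> x (y + \<gamma>)) * (1/2 * \<nu> y \<gamma>))
          (Uop n (root_coeffs S x) p (Uop n (root_coeffs S y) q f)))"
      by (simp only: module_hom.scale[OF lin_Uop] poly.scale_scale add.assoc)
    also have "(1/2 * \<nu> x (y + \<gamma>)) * (1/2 * \<nu> y \<gamma>) = 1/4 * \<nu> x y * (\<nu> x \<gamma> * \<nu> y \<gamma>)"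
      unfolding bil(2)[OF that] by simp
    finally show ?thesis .
  qed
  have "1/4 * \<nu> \<beta> \<alpha> * (\<nu> \<beta> \<gamma> * \<nu> \<alpha> \<gamma>) =
      (1/4 * \<nu> \<alpha> \<beta> * \<nu> (\<alpha> + \<beta>) \<gamma>) * (-1) powi \<lfloor>\<alpha> \<bullet> \<beta>\<rfloor>"
    unfolding bil(1)[OF \<alpha> \<beta>] sym inner_commute[of \<beta> \<alpha>] by (simp only: mult_ac)
  then show ?thesis
    unfolding dist_commutator_def GG[OF \<alpha> \<beta>] GG[OF \<beta> \<alpha>] single_diff[symmetric] add.commute[of \<beta> \<alpha>]
    by (simp only: bil(1)[OF \<alpha> \<beta>] poly.scale_right_diff_distrib poly.scale_scale)
qed


section \<open>Commutators of the operators \<open>\<Gamma>\<close>\<close>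

lemma asymmetry_add_left:
  "asymmetry_function Q \<nu> \<Longrightarrow> x \<in> Q \<Longrightarrow> y \<in> Q \<Longrightarrow> \<gamma> \<in> Q \<Longrightarrow> \<nu> (x + y) \<gamma> = \<nu> x \<gamma> * \<nu> y \<gamma>"
  unfolding asymmetry_function_def by blast

lemma asymmetry_square:
  assumes "asymmetry_function Q \<nu>" "x \<in> Q" "\<gamma> \<in> Q"
  shows "\<nu> x \<gamma> * \<nu> x \<gamma> = 1"
proof -
  have "\<nu> x \<gamma> \<in> {1, -1}" using assms unfolding asymmetry_function_def by blast
  then show ?thesis by auto
qed

lemma single_sum: "(\<Sum>j\<in>J. Poly_Mapping.single C (g j)) = Poly_Mapping.single C (\<Sum>j\<in>J. g j)"
  by (induction J rule: infinite_finite_induct) (simp_all add: single_add)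

context
  fixes n :: nat and Q :: "'h::real_inner set" and \<nu> :: "'h \<Rightarrow> 'h \<Rightarrow> complex"
    and S :: "nat \<Rightarrow> 'h \<times> 'h" and \<alpha> \<beta> :: 'h
  assumes Q: "even_integral_lattice n Q" and S: "orthonormal_cplx_basis n S"
    and \<nu>: "asymmetry_function Q \<nu>" and \<alpha>: "\<alpha> \<in> Q"
begin

lemma Gam_commutator_self_single:
  assumes \<alpha>\<alpha>: "\<alpha> \<bullet> \<alpha> = 2" and \<gamma>: "\<gamma> \<in> Q"
  shows "dist_commutator (Gam n \<nu> S \<alpha>) (Gam n \<nu> S \<alpha>) m k (Poly_Mapping.single (coset2 Q \<gamma>) f) =
    Poly_Mapping.single (coset2 Q \<gamma>) (pscale ((- 1) powi m)
      ((if m + k = 0 then pscale (of_int m) f else 0)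
       + (if odd (m + k) then \<Sum>j=1..n. pscale (root_coeffs S \<alpha> j) (heis j (- (m + k)) f) else 0)))"
proof -
  have \<nu>\<alpha>: "\<nu> \<alpha> \<alpha> = -1"
    using \<nu> \<alpha> \<alpha>\<alpha> unfolding asymmetry_function_def by fastforce
  have "\<gamma> + (\<alpha> + \<alpha>) = \<alpha> + \<alpha> + \<gamma>" by (simp only: add_ac)
  then have "coset2 Q (\<alpha> + \<alpha> + \<gamma>) = coset2 Q \<gamma>"
    using coset2_add_double[OF Q \<alpha>, of \<gamma>] by (simp only:)
  moreover have "1/4 * \<nu> \<alpha> \<alpha> * \<nu> (\<alpha> + \<alpha>) \<gamma> = - 1/4"
    unfolding asymmetry_add_left[OF \<nu> \<alpha> \<alpha> \<gamma>] asymmetry_square[OF \<nu> \<alpha> \<gamma>] \<nu>\<alpha> by simp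
  moreover have "(-1::complex) powi \<lfloor>\<alpha> \<bullet> \<alpha>\<rfloor> = 1" unfolding \<alpha>\<alpha> by simp
  moreover have "(\<Sum>j=1..n. root_coeffs S \<alpha> j * root_coeffs S \<alpha> j) = 4"
    unfolding sum_root_coeffs[OF S] \<alpha>\<alpha> by simp
  note Uop_commutator_4[OF this, of m k f]
  moreover have "(- 1/4) * (- 4 * (- 1) powi m) = (- 1 :: complex) powi m" by simp
  ultimately show ?thesis
    by (simp only: Gam_commutator_single[OF Q \<nu> \<alpha> \<alpha> \<gamma>] poly.scale_scale)
qed

text \<open>\<open>\<alpha> + \<beta>\<close> and \<open>- \<alpha> + \<beta>\<close> have the same class modulo \<open>2Q\<close> and the same sign \<open>\<nu>(_, \<gamma>)\<close>.\<close>

lemma Gam_commutator_1_single: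
  assumes \<beta>: "\<beta> \<in> Q" and \<alpha>\<beta>: "\<alpha> \<bullet> \<beta> = 1" and \<gamma>: "\<gamma> \<in> Q"
  shows "dist_commutator (Gam n \<nu> S \<alpha>) (Gam n \<nu> S \<beta>) m k (Poly_Mapping.single (coset2 Q \<gamma>) f) =
    vscale (\<nu> \<alpha> \<beta> * (- 1) powi m) (Gam n \<nu> S (- \<alpha> + \<beta>) (m + k) (Poly_Mapping.single (coset2 Q \<gamma>) f))"
proof -
  have \<beta>\<alpha>: "- \<alpha> + \<beta> \<in> Q" using even_integral_lattice_add_diff(2)[OF Q \<beta> \<alpha>] by simp
  have "- \<alpha> + \<beta> + \<gamma> + (\<alpha> + \<alpha>) = \<alpha> + \<beta> + \<gamma>" by simp
  then have "coset2 Q (\<alpha> + \<beta> + \<gamma>) = coset2 Q (- \<alpha> + \<beta> + \<gamma>)"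
    using coset2_add_double[OF Q \<alpha>, of "- \<alpha> + \<beta> + \<gamma>"] by (simp only:)
  moreover have "\<nu> (\<alpha> + \<beta>) \<gamma> = \<nu> (- \<alpha> + \<beta>) \<gamma>"
  proof -
    have "\<nu> \<beta> \<gamma> = \<nu> (\<alpha> + (- \<alpha> + \<beta>)) \<gamma>" by simp
    then have "\<nu> (\<alpha> + \<beta>) \<gamma> = (\<nu> \<alpha> \<gamma> * \<nu> \<alpha> \<gamma>) * \<nu> (- \<alpha> + \<beta>) \<gamma>"
      unfolding asymmetry_add_left[OF \<nu> \<alpha> \<beta>\<alpha> \<gamma>] asymmetry_add_left[OF \<nu> \<alpha> \<beta> \<gamma>] by simp
    then show ?thesis unfolding asymmetry_square[OF \<nu> \<alpha> \<gamma>] by simp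
  qed
  moreover have "(-1::complex) powi \<lfloor>\<alpha> \<bullet> \<beta>\<rfloor> = - 1" unfolding \<alpha>\<beta> by simp
  moreover have "(\<Sum>j=1..n. root_coeffs S \<alpha> j * root_coeffs S \<beta> j) = 2"
    unfolding sum_root_coeffs[OF S] \<alpha>\<beta> by simp
  note Uop_commutator_2[OF this, of m k f]
  moreover have "(\<lambda>j. - root_coeffs S \<alpha> j + root_coeffs S \<beta> j) = root_coeffs S (- \<alpha> + \<beta>)"
    unfolding root_coeffs_add root_coeffs_uminus ..
  moreover have "1/4 * \<nu> \<alpha> \<beta> * \<nu> (- \<alpha> + \<beta>) \<gamma> * (2 * (- 1) powi m) =
      (\<nu> \<alpha> \<beta> * (- 1) powi m) * (1/2 * \<nu> (- \<alpha> + \<beta>) \<gamma>)" by simp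
  ultimately show ?thesis
    by (simp only: Gam_commutator_single[OF Q \<nu> \<alpha> \<beta> \<gamma>] Gam_single[OF Q \<nu> \<beta>\<alpha> \<gamma>]
        vscale_single poly.scale_scale root_coeffs_def[of S "- \<alpha> + \<beta>", symmetric])
qed

lemma Gam_commutator_minus_1_single:
  assumes \<beta>: "\<beta> \<in> Q" and \<alpha>\<beta>: "\<alpha> \<bullet> \<beta> = -1" and \<gamma>: "\<gamma> \<in> Q"
  shows "dist_commutator (Gam n \<nu> S \<alpha>) (Gam n \<nu> S \<beta>) m k (Poly_Mapping.single (coset2 Q \<gamma>) f) =
    vscale (\<nu> \<alpha> \<beta>) (Gam n \<nu> S (\<alpha> + \<beta>) (m + k) (Poly_Mapping.single (coset2 Q \<gamma>) f))"
proof -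
  have sum: "\<alpha> + \<beta> \<in> Q" by (rule even_integral_lattice_add_diff(1)[OF Q \<alpha> \<beta>])
  have "\<lfloor>- 1 :: real\<rfloor> = - 1" by linarith
  then have "(-1::complex) powi \<lfloor>\<alpha> \<bullet> \<beta>\<rfloor> = - 1" unfolding \<alpha>\<beta> by simp
  moreover have "(\<Sum>j=1..n. root_coeffs S \<alpha> j * root_coeffs S \<beta> j) = - 2"
    unfolding sum_root_coeffs[OF S] \<alpha>\<beta> by simp
  note Uop_commutator_minus_2[OF this, of m k f, folded root_coeffs_add]
  moreover have "1/4 * \<nu> \<alpha> \<beta> * \<nu> (\<alpha> + \<beta>) \<gamma> * 2 = \<nu> \<alpha> \<beta> * (1/2 * \<nu> (\<alpha> + \<beta>) \<gamma>)" by simp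
  ultimately show ?thesis
    by (simp only: Gam_commutator_single[OF Q \<nu> \<alpha> \<beta> \<gamma>] Gam_single[OF Q \<nu> sum \<gamma>]
        vscale_single poly.scale_scale root_coeffs_def[of S "\<alpha> + \<beta>", symmetric])
qed

lemma Gam_commutator_0_single:
  assumes \<beta>: "\<beta> \<in> Q" and \<alpha>\<beta>: "\<alpha> \<bullet> \<beta> = 0" and \<gamma>: "\<gamma> \<in> Q"
  shows "dist_commutator (Gam n \<nu> S \<alpha>) (Gam n \<nu> S \<beta>) m k (Poly_Mapping.single (coset2 Q \<gamma>) f) = 0"
proof -
  have "(-1::complex) powi \<lfloor>\<alpha> \<bullet> \<beta>\<rfloor> = 1" unfolding \<alpha>\<beta> by simp
  moreover have "(\<Sum>j=1..n. root_coeffs S \<alpha> j * root_coeffs S \<beta> j) = 0"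
    unfolding sum_root_coeffs[OF S] \<alpha>\<beta> by simp
  note Uop_commutator_0[OF this, of m k f]
  ultimately show ?thesis
    by (simp only: Gam_commutator_single[OF Q \<nu> \<alpha> \<beta> \<gamma>] poly.scale_zero_right single_zero)
qed

end

lemma dist_commutator_Gam_add:
  "dist_commutator (Gam n \<nu> S \<alpha>) (Gam n \<nu> S \<beta>) m k (u + v) =
   dist_commutator (Gam n \<nu> S \<alpha>) (Gam n \<nu> S \<beta>) m k u + dist_commutator (Gam n \<nu> S \<alpha>) (Gam n \<nu> S \<beta>) m k v"
  by (simp add: dist_commutator_def Gam_add)

lemma dist_mult_z_plus_w:
  "dist_mult (iota_diff (\<lambda>z w. c * w ^ Suc q / (z + w))) A m k v =
   vscale (- c * (- 1) powi m) (A (m + k - int q) v)"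
  by (subst dist_mult_diagonal[where ?l0.0 = "int q - m"])
    (simp_all only: iota_diff_z_plus_w if_True if_False, simp add: algebra_simps)

lemma dist_mult_z_minus_w:
  "dist_mult (iota_diff (\<lambda>z w. w / (z - w))) A m k v = vscale 1 (A (m + k) v)"
  by (subst dist_mult_diagonal[where ?l0.0 = "- m"])
    (simp_all only: iota_diff_z_minus_w if_True if_False, simp add: algebra_simps)

theorem theorem2p1:
  fixes n :: nat and Q :: "'h::real_inner set" and \<nu> :: "'h \<Rightarrow> 'h \<Rightarrow> complex"
    and S :: "nat \<Rightarrow> 'h \<times> 'h" and \<alpha> \<beta> :: 'h
  assumes "has_dimension TYPE('h) n"
    and "even_integral_lattice n Q"
    and "orthonormal_cplx_basis n S"
    and "asymmetry_function Q \<nu>"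
    and "\<alpha> \<in> Q" and "\<beta> \<in> Q"
  shows "(\<alpha> \<bullet> \<alpha> = 2 \<longrightarrow>
            (\<forall>v\<in>Vcarrier n Q. \<forall>m k.
               dist_commutator (Gam n \<nu> S \<alpha>) (Gam n \<nu> S \<alpha>) m k v =
               vscale (iota_diff (\<lambda>z w. w / (z + w) - w^2 / (z + w)^2) m k) v
               - dist_mult (iota_diff (\<lambda>z w. of_real (sqrt 2) * w^2 / (z + w)))
                   (\<lambda>l u. \<Sum>j=1..n. vscale (cplx_form (cplx_embed \<alpha>) (S j)) (afield j l u)) m k v))
       \<and> (\<alpha> \<bullet> \<beta> = 1 \<longrightarrow>
            (\<forall>v\<in>Vcarrier n Q. \<forall>m k.
               dist_commutator (Gam n \<nu> S \<alpha>) (Gam n \<nu> S \<beta>) m k v =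
               vscale (- \<nu> \<alpha> \<beta>)
                 (dist_mult (iota_diff (\<lambda>z w. w / (z + w))) (Gam n \<nu> S (- \<alpha> + \<beta>)) m k v)))
       \<and> (\<alpha> \<bullet> \<beta> = -1 \<longrightarrow>
            (\<forall>v\<in>Vcarrier n Q. \<forall>m k.
               dist_commutator (Gam n \<nu> S \<alpha>) (Gam n \<nu> S \<beta>) m k v =
               vscale (\<nu> \<alpha> \<beta>)
                 (dist_mult (iota_diff (\<lambda>z w. w / (z - w))) (Gam n \<nu> S (\<alpha> + \<beta>)) m k v)))
       \<and> (\<alpha> \<bullet> \<beta> = 0 \<longrightarrow>
            (\<forall>v\<in>Vcarrier n Q. \<forall>m k.
               dist_commutator (Gam n \<nu> S \<alpha>) (Gam n \<nu> S \<beta>) m k v = 0))"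
proof (intro conjI impI ballI allI)
  note Q = assms(2) and S = assms(3) and \<nu> = assms(4) and \<alpha> = assms(5) and \<beta> = assms(6)
  {
    fix v m k assume \<alpha>2: "\<alpha> \<bullet> \<alpha> = 2" and v: "v \<in> Vcarrier n Q"
    let ?A = "\<lambda>l u. \<Sum>j=1..n. vscale (cplx_form (cplx_embed \<alpha>) (S j)) (afield j l u)"
    let ?c = "\<lambda>m k. if k = - m then of_int m * (- 1) powi m else (0 :: complex)"
    have D: "dist_mult (iota_diff (\<lambda>z w. of_real (sqrt 2) * w^2 / (z + w))) ?A m k v =
        vscale (- of_real (sqrt 2) * (- 1) powi m) (?A (m + k - 1) v)"
      using dist_mult_z_plus_w[of "of_real (sqrt 2)" 1 ?A m k v] by (simp add: numeral_2_eq_2)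
    show "dist_commutator (Gam n \<nu> S \<alpha>) (Gam n \<nu> S \<alpha>) m k v =
       vscale (iota_diff (\<lambda>z w. w / (z + w) - w^2 / (z + w)^2) m k) v
       - dist_mult (iota_diff (\<lambda>z w. of_real (sqrt 2) * w^2 / (z + w))) ?A m k v"
      unfolding D iota_diff_double_pole
    proof (rule additive_eq_on_Vcarrier[OF dist_commutator_Gam_add _ _ v])
      show "vscale c (u + v) - vscale d (?A l (u + v)) =
          (vscale c u - vscale d (?A l u)) + (vscale c v - vscale d (?A l v))" for c d l u v
        by (simp add: vscale_add afield_add sum.distrib)
      fix \<gamma> and f :: xpoly assume \<gamma>: "\<gamma> \<in> Q"
      let ?v = "Poly_Mapping.single (coset2 Q \<gamma>) f"
      let ?H = "if odd (m + k) then \<Sum>j=1..n. pscale (root_coeffs S \<alpha> j) (heis j (- (m + k)) f) else 0"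
      \<comment> \<open>The coefficient of \<open>w ^ (m + k - 1)\<close> in the Heisenberg field has index \<open>- (m + k)\<close>.\<close>
      have "odd (- (m + k - 1) - 1) = odd (m + k)" "- (m + k - 1) - 1 = - (m + k)" by auto
      then have "vscale (- of_real (sqrt 2) * (- 1) powi m) (?A (m + k - 1) ?v)
        = Poly_Mapping.single (coset2 Q \<gamma>) (pscale (- of_real (sqrt 2) * (- 1) powi m)
            (\<Sum>j=1..n. pscale (cplx_form (cplx_embed \<alpha>) (S j)) (if odd (m + k) then heis j (- (m + k)) f else 0)))"
        by (simp only: afield_single vscale_single single_sum)
      also have "pscale (- of_real (sqrt 2) * (- 1) powi m)
            (\<Sum>j=1..n. pscale (cplx_form (cplx_embed \<alpha>) (S j)) (if odd (m + k) then heis j (- (m + k)) f else 0))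
          = pscale (- ((- 1) powi m)) ?H"
        by (simp add: root_coeffs_def poly.scale_sum_right sum_negf mult_ac)
      finally have "vscale (?c m k) ?v - vscale (- of_real (sqrt 2) * (- 1) powi m) (?A (m + k - 1) ?v)
          = Poly_Mapping.single (coset2 Q \<gamma>) (pscale (?c m k) f - pscale (- ((- 1) powi m)) ?H)"
        by (simp only: vscale_single single_diff)
      also have "pscale (?c m k) f - pscale (- ((- 1) powi m)) ?H =
          pscale ((- 1) powi m) ((if m + k = 0 then pscale (of_int m) f else 0) + ?H)"
        by (cases "k = - m") (auto simp: poly.scale_right_distrib mult.commute)
      also have "Poly_Mapping.single (coset2 Q \<gamma>) \<dots> = dist_commutator (Gam n \<nu> S \<alpha>) (Gam n \<nu> S \<alpha>) m k ?v"
        by (rule Gam_commutator_self_single[OF Q S \<nu> \<alpha> \<alpha>2 \<gamma>, symmetric])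
      finally show "dist_commutator (Gam n \<nu> S \<alpha>) (Gam n \<nu> S \<alpha>) m k ?v =
          vscale (?c m k) ?v - vscale (- of_real (sqrt 2) * (- 1) powi m) (?A (m + k - 1) ?v)" ..
    qed
  next
    fix v m k assume "\<alpha> \<bullet> \<beta> = 1" and v: "v \<in> Vcarrier n Q"
    have D: "dist_mult (iota_diff (\<lambda>z w. w / (z + w))) (Gam n \<nu> S (- \<alpha> + \<beta>)) m k v =
        vscale (- ((- 1) powi m)) (Gam n \<nu> S (- \<alpha> + \<beta>) (m + k) v)"
      using dist_mult_z_plus_w[of 1 0] by simp
    have "vscale (- \<nu> \<alpha> \<beta>) (vscale (- ((- 1) powi m)) u) = vscale (\<nu> \<alpha> \<beta> * (- 1) powi m) u" for u :: "'h Vspace"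
      by (rule poly_mapping_eqI) (simp add: lookup_vscale)
    moreover have "dist_commutator (Gam n \<nu> S \<alpha>) (Gam n \<nu> S \<beta>) m k v =
       vscale (\<nu> \<alpha> \<beta> * (- 1) powi m) (Gam n \<nu> S (- \<alpha> + \<beta>) (m + k) v)"
      by (rule additive_eq_on_Vcarrier[OF dist_commutator_Gam_add _ _ v])
        (simp_all only: vscale_add Gam_add Gam_commutator_1_single[OF Q S \<nu> \<alpha> \<beta> \<open>\<alpha> \<bullet> \<beta> = 1\<close>])
    ultimately show "dist_commutator (Gam n \<nu> S \<alpha>) (Gam n \<nu> S \<beta>) m k v =
       vscale (- \<nu> \<alpha> \<beta>) (dist_mult (iota_diff (\<lambda>z w. w / (z + w))) (Gam n \<nu> S (- \<alpha> + \<beta>)) m k v)"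
      by (simp only: D)
  next
    fix v m k assume "\<alpha> \<bullet> \<beta> = -1" and v: "v \<in> Vcarrier n Q"
    have "vscale 1 u = u" for u :: "'h Vspace"
      by (rule poly_mapping_eqI) (simp add: lookup_vscale)
    moreover have "dist_commutator (Gam n \<nu> S \<alpha>) (Gam n \<nu> S \<beta>) m k v =
       vscale (\<nu> \<alpha> \<beta>) (Gam n \<nu> S (\<alpha> + \<beta>) (m + k) v)"
      by (rule additive_eq_on_Vcarrier[OF dist_commutator_Gam_add _ _ v])
        (simp_all only: vscale_add Gam_add Gam_commutator_minus_1_single[OF Q S \<nu> \<alpha> \<beta> \<open>\<alpha> \<bullet> \<beta> = -1\<close>])
    ultimately show "dist_commutator (Gam n \<nu> S \<alpha>) (Gam n \<nu> S \<beta>) m k v =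
       vscale (\<nu> \<alpha> \<beta>) (dist_mult (iota_diff (\<lambda>z w. w / (z - w))) (Gam n \<nu> S (\<alpha> + \<beta>)) m k v)"
      by (simp only: dist_mult_z_minus_w)
  next
    fix v m k assume "\<alpha> \<bullet> \<beta> = 0" and v: "v \<in> Vcarrier n Q"
    show "dist_commutator (Gam n \<nu> S \<alpha>) (Gam n \<nu> S \<beta>) m k v = 0"
      by (rule additive_eq_on_Vcarrier[OF dist_commutator_Gam_add _ _ v, where G = "\<lambda>_. 0"])
        (simp_all only: Gam_commutator_0_single[OF Q S \<nu> \<alpha> \<beta> \<open>\<alpha> \<bullet> \<beta> = 0\<close>] add_0_left)
  }
qed

end
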